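(* Let $n\ge 3$. For a Euclidean, hyperbolic or spherical cyclic polygon with vertices $P_1,P_2,\dots,P_n$ and side lengths $|P_iP_{i+1}|=l_{i,i+1}$ (where $n+1=1$, so that $l_{n1}=|P_nP_1|$), the length $l_{ij}$ of the diagonal $P_iP_j$ $(|j-i|\geq 2)$ is given by $$s(l_{ij})=F_{ij}\bigl(s(l_{12}),s(l_{23}),\dots,s(l_{n1})\bigr)$$ for some algebraic function $F_{ij}$ which is independent of the three kinds of geometry. The radius $r$ of the circumcircle satisfies $$s(2r)=G\bigl(s(l_{12}),s(l_{23}),\dots,s(l_{n1})\bigr)$$ for some algebraic function $G$ which is independent of the three kinds of geometry.
   Context: The three geometries are those of the Euclidean plane, the hyperbolic plane (curvature $-1$) and the unit sphere; $|PQ|$ denotes the distance between $P$ and $Q$ in the geometry considered. A cyclic polygon is a polygon whose vertices all lie on one circle, called its circumcircle; $r$ is the radius of that circle in the geometry considered. The function $s$ is defined by $s(x)=\frac{x}{2}$ in Euclidean geometry, $s(x)=\sinh\frac{x}{2}$ in hyperbolic geometry, and $s(x)=\sin\frac{x}{2}$ in spherical geometry. "Independent of the three kinds of geometry" means that the same functions $F_{ij}$ and $G$ serve in all three geometries. *)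

theory Defs
  imports "HOL-Analysis.Analysis" "HOL-Library.Poly_Mapping"
    "HOL-Computational_Algebra.Factorial_Ring"
begin

section \<open>The hyperbolic plane and the unit sphere\<close>

text \<open>The hyperbolic plane of curvature $-1$ is the upper sheet of the hyperboloid in Minkowski
  space; the Minkowski product of two of its points is at most $-1$, so the argument of
  \<^const>\<open>arcosh\<close> below is at least $1$ there.\<close>

definition minkowski :: "real ^ 3 \<Rightarrow> real ^ 3 \<Rightarrow> real" where
  "minkowski x y = x $ 1 * y $ 1 + x $ 2 * y $ 2 - x $ 3 * y $ 3"

definition hyperbolic_plane :: "(real ^ 3) set" where
  "hyperbolic_plane = {x. minkowski x x = - 1 \<and> x $ 3 > 0}"

definition hyperbolic_dist :: "real ^ 3 \<Rightarrow> real ^ 3 \<Rightarrow> real" where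
  "hyperbolic_dist x y = arcosh (- minkowski x y)"

definition unit_sphere :: "(real ^ 3) set" where
  "unit_sphere = sphere 0 1"

definition spherical_dist :: "real ^ 3 \<Rightarrow> real ^ 3 \<Rightarrow> real" where
  "spherical_dist x y = arccos (x \<bullet> y)"

definition s_euclidean :: "real \<Rightarrow> real" where
  "s_euclidean x = x / 2"

definition s_hyperbolic :: "real \<Rightarrow> real" where
  "s_hyperbolic x = sinh (x / 2)"

definition s_spherical :: "real \<Rightarrow> real" where
  "s_spherical x = sin (x / 2)"


section \<open>Cyclic polygons\<close>

text \<open>A geometry is given by its set of points \<open>M\<close> and its distance \<open>d\<close>.

  In each of the three geometries the following set is the unique shortest arc from \<open>A\<close> to \<open>B\<close>,
  except for antipodal points of the sphere: they have no unique shortest arc, and the set is the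
  whole sphere. So the condition in \<open>polygon\<close> never holds for a spherical polygon with a pair of
  antipodal consecutive vertices.\<close>

definition segment :: "'a set \<Rightarrow> ('a \<Rightarrow> 'a \<Rightarrow> real) \<Rightarrow> 'a \<Rightarrow> 'a \<Rightarrow> 'a set" where
  "segment M d A B = {X \<in> M. d A X + d X B = d A B}"

text \<open>The vertex list \<open>P\<close> is indexed by $0, \dots, n-1$. The successor of the last index is $0$.\<close>

definition next_vertex :: "'a list \<Rightarrow> nat \<Rightarrow> 'a" where
  "next_vertex P i = P ! (Suc i mod length P)"

text \<open>Polygons are simple: two different sides meet exactly in the vertices they share.\<close>

definition polygon :: "'a set \<Rightarrow> ('a \<Rightarrow> 'a \<Rightarrow> real) \<Rightarrow> 'a list \<Rightarrow> bool" where
  "polygon M d P \<longleftrightarrow>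
     length P \<ge> 3 \<and> set P \<subseteq> M \<and> distinct P \<and>
     (\<forall>i < length P. \<forall>j < length P. i \<noteq> j \<longrightarrow>
        segment M d (P ! i) (next_vertex P i) \<inter> segment M d (P ! j) (next_vertex P j) =
        {P ! i, next_vertex P i} \<inter> {P ! j, next_vertex P j})"

definition cyclic_polygon ::
    "'a set \<Rightarrow> ('a \<Rightarrow> 'a \<Rightarrow> real) \<Rightarrow> nat \<Rightarrow> 'a list \<Rightarrow> real \<Rightarrow> bool" where
  "cyclic_polygon M d n P r \<longleftrightarrow>
     length P = n \<and> polygon M d P \<and> r > 0 \<and> (\<exists>c \<in> M. \<forall>X \<in> set P. d c X = r)"

definition side_values :: "(real \<Rightarrow> real) \<Rightarrow> ('a \<Rightarrow> 'a \<Rightarrow> real) \<Rightarrow> 'a list \<Rightarrow> real list" where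
  "side_values s d P = map (\<lambda>i. s (d (P ! i) (next_vertex P i))) [0..<length P]"

text \<open>The tuples at which the functions of the theorem are evaluated, from all three geometries.\<close>

definition admissible_values :: "nat \<Rightarrow> real list set" where
  "admissible_values n =
     {side_values s_euclidean dist P | (P :: (real ^ 2) list) r. cyclic_polygon UNIV dist n P r} \<union>
     {side_values s_hyperbolic hyperbolic_dist P | P r.
        cyclic_polygon hyperbolic_plane hyperbolic_dist n P r} \<union>
     {side_values s_spherical spherical_dist P | P r.
        cyclic_polygon unit_sphere spherical_dist n P r}"


section \<open>Algebraic functions\<close>

text \<open>Polynomials over the reals in the variables $x_0, x_1, \dots$: a finitely supported map from
  exponent vectors to coefficients, with the convolution product.\<close>

type_synonym mpoly = "(nat \<Rightarrow>\<^sub>0 nat) \<Rightarrow>\<^sub>0 real"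

definition mpoly_vars :: "mpoly \<Rightarrow> nat set" where
  "mpoly_vars p = (\<Union>m \<in> Poly_Mapping.keys p. Poly_Mapping.keys m)"

definition mpoly_eval :: "mpoly \<Rightarrow> (nat \<Rightarrow> real) \<Rightarrow> real" where
  "mpoly_eval p x =
     (\<Sum>m \<in> Poly_Mapping.keys p. Poly_Mapping.lookup p m *
        (\<Prod>v \<in> Poly_Mapping.keys m. x v ^ Poly_Mapping.lookup m v))"

text \<open>A function of \<open>n\<close> real variables is algebraic on \<open>D\<close> if it is a root there of an irreducible
  polynomial. The variables $x_0, \dots, x_{n-1}$ stand for the arguments and $x_n$, which has to
  occur, stands for the value.\<close>

definition algebraic_on :: "nat \<Rightarrow> real list set \<Rightarrow> (real list \<Rightarrow> real) \<Rightarrow> bool" where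
  "algebraic_on n D f \<longleftrightarrow>
     (\<exists>Q :: mpoly. irreducible Q \<and> mpoly_vars Q \<subseteq> {..n} \<and> n \<in> mpoly_vars Q \<and>
        (\<forall>a \<in> D. mpoly_eval Q (\<lambda>v. (a @ [f a]) ! v) = 0))"

end

(* The cyclic polygons of all three geometries have a common model. The circumcircle lies in an affine
   plane of R^2, R^3 or Minkowski space on which the ambient form is Euclidean; there it is a circle of
   radius R = s(2r), and s(|PQ|) is half the Euclidean chord PQ. Sides of a simple polygon do not
   cross, so the vertices are in cyclic order: s(l_{k,k+1}) = R sin(theta_k) with theta_k > 0 and
   sum pi, and s(l_ij) = R sin(theta_i + ... + theta_{j-1}). The side values determine R and all the
   theta_k, which gives F_ij and G.

   These are trigonometric parametrizations with n parameters, so the n + 1 quantities formed by the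
   sides and one further value satisfy a polynomial relation by a dimension count. The polynomials
   vanishing on the parametrization form a prime ideal, by analytic continuation along lines in the
   parameter space, hence a nonzero one of least degree is irreducible. It involves the last variable
   because the side values contain a box of R^n. *)
theory Submission
  imports Defs "HOL-Complex_Analysis.Complex_Analysis"
begin

section \<open>Polynomials vanishing on a parametrized set\<close>

text \<open>A cyclic polygon need not contain its circumcentre. If the centre lies outside, the
  angle of the longest side is obtuse, and arcsines of the sides do not recover the angles.
  Uniqueness of the radius is therefore proved by comparing sines of angle sums that leave out the
  longest side.

  The functions F_ij and G cannot be read off their polynomial relations, since a polynomial may
  have several roots. They are defined from the unique radius and angles, and the relations are
  proved separately.

  In the dimension count the scale R disappears by homogeneity: all monomials of degree D carry the
  same factor \<open>R ^ D\<close>. What is left is n - 1 free angles against monomials in n + 1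
  variables of fixed degree, that is, with n free exponents.

  Analytic continuation needs a parameter space that contains the line through any two of its
  points. So in the algebraic part the angles and the scale range over all reals; positivity of the
  angles matters only for geometry and uniqueness.\<close>

lemma poly_mapping_eq_sum_single:
  "p = (\<Sum>m\<in>Poly_Mapping.keys p. Poly_Mapping.single m (Poly_Mapping.lookup p m))"
  by (rule poly_mapping_eqI)
    (auto simp: lookup_sum lookup_single when_def in_keys_iff)

lemma poly_mapping_plus_induct [case_names zero plus]:
  assumes "P 0" "\<And>p m c. P p \<Longrightarrow> P (Poly_Mapping.single m c + p)"
  shows "P (p :: 'a \<Rightarrow>\<^sub>0 'b::comm_monoid_add)"
proof -
  have "P (\<Sum>m\<in>A. Poly_Mapping.single m (Poly_Mapping.lookup p m))" if "finite A" for A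
    using that by (induction A) (auto intro: assms)
  from this[OF finite_keys, of p] show ?thesis
    by (subst poly_mapping_eq_sum_single)
qed

section \<open>Evaluation is a ring homomorphism\<close>

definition eval_monom :: "(nat \<Rightarrow>\<^sub>0 nat) \<Rightarrow> (nat \<Rightarrow> real) \<Rightarrow> real" where
  "eval_monom m x = (\<Prod>v\<in>Poly_Mapping.keys m. x v ^ Poly_Mapping.lookup m v)"

lemma eval_monom_superset:
  assumes "finite A" "Poly_Mapping.keys m \<subseteq> A"
  shows "eval_monom m x = (\<Prod>v\<in>A. x v ^ Poly_Mapping.lookup m v)"
  unfolding eval_monom_def
  by (rule prod.mono_neutral_left) (use assms in \<open>auto simp: in_keys_iff\<close>)

lemma eval_monom_add: "eval_monom (m + m') x = eval_monom m x * eval_monom m' x"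
proof -
  let ?A = "Poly_Mapping.keys m \<union> Poly_Mapping.keys m'"
  have "finite ?A" "Poly_Mapping.keys (m + m') \<subseteq> ?A"
    using keys_add[of m m'] by auto
  then show ?thesis
    by (simp add: eval_monom_superset[of ?A] lookup_add power_add prod.distrib)
qed

lemma mpoly_eval_monom:
  "mpoly_eval p x = (\<Sum>m\<in>Poly_Mapping.keys p. Poly_Mapping.lookup p m * eval_monom m x)"
  by (simp add: mpoly_eval_def eval_monom_def)

lemma mpoly_eval_superset:
  assumes "finite A" "Poly_Mapping.keys p \<subseteq> A"
  shows "mpoly_eval p x = (\<Sum>m\<in>A. Poly_Mapping.lookup p m * eval_monom m x)"
  unfolding mpoly_eval_monom
  by (rule sum.mono_neutral_left) (use assms in \<open>auto simp: in_keys_iff\<close>)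

lemma mpoly_eval_0 [simp]: "mpoly_eval 0 x = 0"
  by (simp add: mpoly_eval_def)

lemma mpoly_eval_1 [simp]: "mpoly_eval 1 x = 1"
  by (simp add: mpoly_eval_def)

lemma mpoly_eval_single: "mpoly_eval (Poly_Mapping.single m c) x = c * eval_monom m x"
  by (cases "c = 0") (auto simp: mpoly_eval_monom)

lemma mpoly_eval_add: "mpoly_eval (p + q) x = mpoly_eval p x + mpoly_eval q x"
  unfolding mpoly_eval_monom by (rule setsum_keys_plus_distrib) (auto simp: algebra_simps)

lemma mpoly_eval_mult: "mpoly_eval (p * q) x = mpoly_eval p x * mpoly_eval q x"
proof (induction p rule: poly_mapping_plus_induct)
  case (plus p m c)
  have "mpoly_eval (Poly_Mapping.single m c * q) x
      = mpoly_eval (Poly_Mapping.single m c) x * mpoly_eval q x"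
  proof (induction q rule: poly_mapping_plus_induct)
    case (plus q m' c')
    then show ?case
      by (simp add: distrib_left mpoly_eval_add mult_single mpoly_eval_single eval_monom_add)
  qed simp
  with plus show ?case
    by (simp add: distrib_right mpoly_eval_add)
qed simp

lemma mpoly_eval_cong:
  assumes "\<And>v. v \<in> mpoly_vars p \<Longrightarrow> x v = y v"
  shows "mpoly_eval p x = mpoly_eval p y"
proof -
  have "x v = y v" if "m \<in> Poly_Mapping.keys p" "v \<in> Poly_Mapping.keys m" for m v
    using assms that by (auto simp: mpoly_vars_def)
  then show ?thesis
    by (simp add: mpoly_eval_def)
qed

section \<open>Degrees with respect to a set of variables\<close>

definition mweight :: "nat set \<Rightarrow> (nat \<Rightarrow>\<^sub>0 nat) \<Rightarrow> nat" where
  "mweight S m = (\<Sum>v\<in>Poly_Mapping.keys m. if v \<in> S then Poly_Mapping.lookup m v else 0)"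

lemma mweight_add: "mweight S (m + m') = mweight S m + mweight S m'"
  unfolding mweight_def by (rule setsum_keys_plus_distrib) auto

lemma mweight_eq_0_iff: "mweight S m = 0 \<longleftrightarrow> Poly_Mapping.keys m \<inter> S = {}"
  by (auto simp: mweight_def in_keys_iff)

text \<open>Taking \<open>S = UNIV\<close> gives the total degree, and \<open>S = - {..n}\<close>
  detects variables beyond \<open>n\<close>. Multiplicativity for general \<open>S\<close> thus
  controls both the degree and the variables of a factor.\<close>

definition wdegree :: "nat set \<Rightarrow> mpoly \<Rightarrow> nat" where
  "wdegree S p = Max (insert 0 (mweight S ` Poly_Mapping.keys p))"

lemma mweight_le_wdegree: "m \<in> Poly_Mapping.keys p \<Longrightarrow> mweight S m \<le> wdegree S p"
  by (simp add: wdegree_def)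

lemma wdegree_attained:
  assumes "p \<noteq> 0"
  obtains m where "m \<in> Poly_Mapping.keys p" "mweight S m = wdegree S p"
proof -
  have ne: "Poly_Mapping.keys p \<noteq> {}"
    using assms by (metis keys_eq_empty poly_mapping_eqI not_in_keys_iff_lookup_eq_zero
        emptyE lookup_zero)
  then have "wdegree S p = Max (mweight S ` Poly_Mapping.keys p)"
    unfolding wdegree_def by (subst Max_insert) auto
  with ne have "wdegree S p \<in> mweight S ` Poly_Mapping.keys p"
    by (metis Max_in finite_imageI finite_keys image_is_empty)
  then show thesis using that by auto
qed

definition restrict_monoms :: "((nat \<Rightarrow>\<^sub>0 nat) \<Rightarrow> bool) \<Rightarrow> mpoly \<Rightarrow> mpoly" where
  "restrict_monoms P p = Abs_poly_mapping (\<lambda>m. if P m then Poly_Mapping.lookup p m else 0)"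

lemma lookup_restrict_monoms:
  "Poly_Mapping.lookup (restrict_monoms P p) m = (if P m then Poly_Mapping.lookup p m else 0)"
proof -
  have "finite {m. (if P m then Poly_Mapping.lookup p m else 0) \<noteq> 0}"
    by (rule finite_subset[OF _ finite_keys[of p]]) (auto simp: in_keys_iff)
  then show ?thesis
    by (simp add: restrict_monoms_def)
qed

lemma keys_restrict_monoms:
  "Poly_Mapping.keys (restrict_monoms P p) = {m \<in> Poly_Mapping.keys p. P m}"
  by (auto simp: in_keys_iff lookup_restrict_monoms split: if_splits)

lemma restrict_monoms_split: "p = restrict_monoms P p + restrict_monoms (\<lambda>m. \<not> P m) p"
  by (rule poly_mapping_eqI) (simp add: lookup_add lookup_restrict_monoms)

text \<open>The parts of top weight have a nonzero product, as there are no zero divisors. Every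
  other contribution to \<open>p * q\<close> has strictly smaller weight, so nothing cancels a
  monomial of that product.\<close>

lemma wdegree_mult:
  assumes "p \<noteq> 0" "q \<noteq> 0"
  shows "wdegree S (p * q) = wdegree S p + wdegree S q"
proof (rule antisym)
  have "p * q \<noteq> 0" using assms by simp
  then obtain m where m: "m \<in> Poly_Mapping.keys (p * q)" "mweight S m = wdegree S (p * q)"
    by (rule wdegree_attained)
  from m(1) obtain a b where "m = a + b" "a \<in> Poly_Mapping.keys p" "b \<in> Poly_Mapping.keys q"
    using keys_mult[of p q] by auto
  then show "wdegree S (p * q) \<le> wdegree S p + wdegree S q"
    using m(2) by (metis mweight_add add_mono mweight_le_wdegree)
next
  define top where "top r = restrict_monoms (\<lambda>m. mweight S m = wdegree S r) r" for r
  define low where "low r = restrict_monoms (\<lambda>m. mweight S m \<noteq> wdegree S r) r" for r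
  have split: "r = top r + low r" for r
    unfolding top_def low_def by (rule restrict_monoms_split)
  have top_ne: "top r \<noteq> 0" if r: "r \<noteq> 0" for r
  proof -
    obtain m where "m \<in> Poly_Mapping.keys r" "mweight S m = wdegree S r"
      using wdegree_attained[OF r] by blast
    then have "m \<in> Poly_Mapping.keys (top r)"
      by (simp add: top_def keys_restrict_monoms)
    then show ?thesis by auto
  qed
  have top_w: "mweight S m = wdegree S r" if "m \<in> Poly_Mapping.keys (top r)" for m r
    using that by (simp add: top_def keys_restrict_monoms)
  have low_w: "mweight S m < wdegree S r" if "m \<in> Poly_Mapping.keys (low r)" for m r
    using that mweight_le_wdegree[of m r S] by (auto simp: low_def keys_restrict_monoms)
  have "top p * top q \<noteq> 0" using top_ne assms by simp
  then obtain m where m: "m \<in> Poly_Mapping.keys (top p * top q)"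
    by (metis all_not_in_conv wdegree_attained)
  then have mw: "mweight S m = wdegree S p + wdegree S q"
    using keys_mult[of "top p" "top q"] by (auto simp: mweight_add dest!: top_w)
  have low_m: "m \<notin> Poly_Mapping.keys (top p * low q)" "m \<notin> Poly_Mapping.keys (low p * q)"
  proof -
    show "m \<notin> Poly_Mapping.keys (top p * low q)"
    proof
      assume "m \<in> Poly_Mapping.keys (top p * low q)"
      then obtain a b where "m = a + b" "a \<in> Poly_Mapping.keys (top p)"
          "b \<in> Poly_Mapping.keys (low q)"
        using keys_mult[of "top p" "low q"] by auto
      then show False
        using mw top_w[of a p] low_w[of b q] by (simp add: mweight_add)
    qed
    show "m \<notin> Poly_Mapping.keys (low p * q)"
    proof
      assume "m \<in> Poly_Mapping.keys (low p * q)"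
      then obtain a b where "m = a + b" "a \<in> Poly_Mapping.keys (low p)"
          "b \<in> Poly_Mapping.keys q"
        using keys_mult[of "low p" q] by auto
      then show False
        using mw low_w[of a p] mweight_le_wdegree[of b q S] by (simp add: mweight_add)
    qed
  qed
  have "p * q = (top p + low p) * q"
    using split[of p] by simp
  also have "\<dots> = top p * (top q + low q) + low p * q"
    using split[of q] by (simp add: distrib_right)
  also have "\<dots> = top p * top q + (top p * low q + low p * q)"
    by (simp add: algebra_simps)
  finally have "Poly_Mapping.lookup (p * q) m = Poly_Mapping.lookup (top p * top q) m"
    using low_m by (simp add: lookup_add in_keys_iff)
  with m have "m \<in> Poly_Mapping.keys (p * q)"
    by (simp add: in_keys_iff)
  with mw show "wdegree S p + wdegree S q \<le> wdegree S (p * q)"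
    by (metis mweight_le_wdegree)
qed

lemma wdegree_eq_0_iff: "wdegree S p = 0 \<longleftrightarrow> mpoly_vars p \<inter> S = {}"
proof -
  have "wdegree S p = 0 \<longleftrightarrow> (\<forall>m\<in>Poly_Mapping.keys p. mweight S m = 0)"
    by (metis le_zero_eq mweight_le_wdegree wdegree_attained wdegree_def finite.emptyI keys_zero
        image_empty Max_singleton)
  then show ?thesis
    by (auto simp: mweight_eq_0_iff mpoly_vars_def)
qed

lemma is_unit_if_no_vars:
  assumes "(p :: mpoly) \<noteq> 0" "mpoly_vars p = {}"
  shows "p dvd 1"
proof -
  have keys: "Poly_Mapping.keys p \<subseteq> {0}"
    using assms(2) by (force simp: mpoly_vars_def)
  define c where "c = Poly_Mapping.lookup p 0"
  have p: "p = Poly_Mapping.single 0 c"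
    by (rule poly_mapping_eqI)
      (use keys in \<open>auto simp: lookup_single when_def c_def in_keys_iff\<close>)
  with assms have "c \<noteq> 0" by auto
  then have "p * Poly_Mapping.single 0 (inverse c) = 1"
    by (simp add: p mult_single)
  then show ?thesis by (metis dvd_triv_left)
qed

text \<open>A vanishing polynomial of least total degree is irreducible as soon as the vanishing ideal
  is prime.\<close>

lemma irreducible_vanishing_polynomial:
  fixes X :: "(nat \<Rightarrow> real) set"
  assumes "X \<noteq> {}"
    and prime: "\<And>p q. \<forall>x\<in>X. mpoly_eval (p * q) x = 0 \<Longrightarrow>
        (\<forall>x\<in>X. mpoly_eval p x = 0) \<or> (\<forall>x\<in>X. mpoly_eval q x = 0)"
    and ex: "\<exists>p. p \<noteq> 0 \<and> mpoly_vars p \<subseteq> {..n} \<and> (\<forall>x\<in>X. mpoly_eval p x = 0)"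
  shows "\<exists>p. irreducible p \<and> mpoly_vars p \<subseteq> {..n} \<and> (\<forall>x\<in>X. mpoly_eval p x = 0)"
proof -
  define I where "I p \<longleftrightarrow> p \<noteq> 0 \<and> mpoly_vars p \<subseteq> {..n} \<and> (\<forall>x\<in>X. mpoly_eval p x = 0)" for p
  obtain p where p: "I p" and min: "\<And>q. I q \<Longrightarrow> wdegree UNIV p \<le> wdegree UNIV q"
    using ex exists_least_iff[of "\<lambda>d. \<exists>p. I p \<and> wdegree UNIV p = d"]
    unfolding I_def[symmetric] by (metis not_less)
  \<comment> \<open>A factor \<open>a\<close> that vanishes on \<open>X\<close> competes with
    \<open>p\<close> for the least degree: multiplicativity of the degree outside
    \<open>{..n}\<close> keeps its variables in range. Minimality then leaves degree 0 for the
    cofactor \<open>b\<close>.\<close>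
  have unit: "b dvd 1" if ab: "p = a * b" and van: "\<forall>x\<in>X. mpoly_eval a x = 0" for a b
  proof -
    have ne: "a \<noteq> 0" "b \<noteq> 0" using ab p by (auto simp: I_def)
    have "wdegree (- {..n}) p = 0"
      using p unfolding wdegree_eq_0_iff I_def by auto
    then have "wdegree (- {..n}) a = 0"
      using wdegree_mult[OF ne] ab by simp
    then have "mpoly_vars a \<subseteq> {..n}"
      unfolding wdegree_eq_0_iff by auto
    then have "I a" using ne van by (simp add: I_def)
    from min[OF this] have "wdegree UNIV b = 0"
      using wdegree_mult[OF ne, of UNIV] ab by simp
    then show ?thesis
      using is_unit_if_no_vars[OF ne(2)] by (simp add: wdegree_eq_0_iff)
  qed
  have "irreducible p"
  proof (rule irreducibleI)
    show "p \<noteq> 0" using p by (simp add: I_def)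
    show "\<not> p dvd 1"
    proof
      assume "p dvd 1"
      then obtain q where "1 = p * q" by (elim dvdE)
      then have "1 = mpoly_eval p x * mpoly_eval q x" for x
        by (metis mpoly_eval_1 mpoly_eval_mult)
      with p \<open>X \<noteq> {}\<close> show False by (metis I_def ex_in_conv mult_zero_left zero_neq_one)
    qed
    show "a dvd 1 \<or> b dvd 1" if "p = a * b" for a b
      using prime[of a b] unit[of a b] unit[of b a] that p by (auto simp: I_def mult.commute)
  qed
  with p show ?thesis by (auto simp: I_def)
qed

text \<open>Kronecker's substitution \<open>x\<^sub>v = t ^ (N ^ v)\<close> maps distinct monomials of small degree to
  distinct powers of \<open>t\<close>.\<close>

lemma sum_digits_less:
  fixes a :: "nat \<Rightarrow> nat"
  assumes "\<And>v. v < n \<Longrightarrow> a v < N"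
  shows "(\<Sum>v<n. a v * N ^ v) < N ^ n"
  using assms
proof (induction n)
  case (Suc n)
  then have "(\<Sum>v<n. a v * N ^ v) < N ^ n" "Suc (a n) \<le> N" by (auto simp: Suc_le_eq)
  then have "(\<Sum>v<Suc n. a v * N ^ v) < N ^ n + a n * N ^ n" "Suc (a n) * N ^ n \<le> N * N ^ n"
    by (simp, meson mult_le_mono1)
  then show ?case by simp
qed simp

lemma sum_digits_inject:
  fixes a b :: "nat \<Rightarrow> nat"
  assumes "\<And>v. v < n \<Longrightarrow> a v < N" "\<And>v. v < n \<Longrightarrow> b v < N"
    and "(\<Sum>v<n. a v * N ^ v) = (\<Sum>v<n. b v * N ^ v)" "v < n"
  shows "a v = b v"
  using assms
proof (induction n arbitrary: v)
  case (Suc n)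
  have less: "(\<Sum>v<n. a v * N ^ v) < N ^ n" "(\<Sum>v<n. b v * N ^ v) < N ^ n"
    using Suc.prems by (auto intro!: sum_digits_less)
  have eq: "(\<Sum>v<n. a v * N ^ v) + a n * N ^ n = (\<Sum>v<n. b v * N ^ v) + b n * N ^ n"
    using Suc.prems(3) by simp
  have "(x + y * N ^ n) div N ^ n = y" if "x < N ^ n" for x y
  proof -
    have "N ^ n \<noteq> 0" using that by linarith
    from div_mult_self1[OF this, of x y] div_less[OF that] show ?thesis by simp
  qed
  then have n: "a n = b n" using eq less by metis
  with eq have "(\<Sum>v<n. a v * N ^ v) = (\<Sum>v<n. b v * N ^ v)" by simp
  then have "a v = b v" if "v < n" for v
    using Suc.IH Suc.prems that by (metis less_SucI)
  with n Suc.prems(4) show ?case by (auto simp: less_Suc_eq)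
qed simp

text \<open>Kronecker's curve stays in the box for all \<open>t\<close> in an interval to the right
  of 1, so the resulting univariate polynomial has infinitely many roots. Since \<open>code\<close>
  is injective on the monomials of \<open>p\<close>, its coefficients are exactly those of
  \<open>p\<close>.\<close>

lemma mpoly_eq_0_if_vanishes_on_box:
  fixes p :: mpoly
  assumes vars: "mpoly_vars p \<subseteq> {..<n}" and "1 < b"
    and van: "\<And>x. (\<And>v. v < n \<Longrightarrow> 1 \<le> x v \<and> x v \<le> b) \<Longrightarrow> mpoly_eval p x = 0"
  shows "p = 0"
proof -
  define N where "N = Suc (Max (insert 0 (\<Union>m\<in>Poly_Mapping.keys p. Poly_Mapping.range m)))"
  define code where "code m = (\<Sum>v<n. Poly_Mapping.lookup m v * N ^ v)" for m
  have keys: "Poly_Mapping.keys m \<subseteq> {..<n}" if "m \<in> Poly_Mapping.keys p" for m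
    using vars that by (auto simp: mpoly_vars_def)
  have bound: "Poly_Mapping.lookup m v < N" if "m \<in> Poly_Mapping.keys p" for m v
  proof (cases "v \<in> Poly_Mapping.keys m")
    case True
    then have "Poly_Mapping.lookup m v \<le> N - 1"
      unfolding N_def using that by (auto intro!: Max_ge in_keys_lookup_in_range)
    then show ?thesis by (simp add: N_def)
  qed (simp add: N_def in_keys_iff)
  have inj: "inj_on code (Poly_Mapping.keys p)"
  proof (rule inj_onI)
    fix m m' assume m: "m \<in> Poly_Mapping.keys p" "m' \<in> Poly_Mapping.keys p" "code m = code m'"
    then have "Poly_Mapping.lookup m v = Poly_Mapping.lookup m' v" if "v < n" for v
      using sum_digits_inject[of n "Poly_Mapping.lookup m" N "Poly_Mapping.lookup m'" v] bound that
      by (simp add: code_def)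
    moreover have "Poly_Mapping.lookup m v = Poly_Mapping.lookup m' v" if "\<not> v < n" for v
      using keys m that by (metis in_keys_iff lessThan_iff subsetD)
    ultimately show "m = m'"
      by (metis poly_mapping_eqI)
  qed
  define q :: "real poly" where
    "q = (\<Sum>m\<in>Poly_Mapping.keys p. Polynomial.monom (Poly_Mapping.lookup p m) (code m))"
  have q_eval: "poly q t = mpoly_eval p (\<lambda>v. t ^ (N ^ v))" for t
  proof -
    have "eval_monom m (\<lambda>v. t ^ (N ^ v)) = t ^ code m" if "m \<in> Poly_Mapping.keys p" for m
      using keys[OF that]
      by (simp add: eval_monom_superset[of "{..<n}"] code_def power_mult [symmetric] power_sum
          mult.commute)
    then show ?thesis
      by (simp add: q_def poly_sum poly_monom mpoly_eval_monom)
  qed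
  \<comment> \<open>With this root of \<open>b\<close>, every coordinate \<open>t ^ (N ^ v)\<close>
    with \<open>v < n\<close> stays between 1 and \<open>b\<close> as long as
    \<open>1 \<le> t\<close> and \<open>t \<le> d\<close>.\<close>
  define d where "d = b powr (1 / real (N ^ n))"
  have N: "N > 0" by (simp add: N_def)
  have d: "1 < d" "d ^ (N ^ n) = b"
    using N \<open>1 < b\<close> by (auto simp: d_def powr_realpow [symmetric] powr_powr)
  have "poly q t = 0" if t: "t \<in> {1..d}" for t
    unfolding q_eval
  proof (rule van)
    fix v assume "v < n"
    then have "t ^ (N ^ v) \<le> t ^ (N ^ n)"
      using t N by (intro power_increasing) auto
    also have "\<dots> \<le> d ^ (N ^ n)"
      using t by (intro power_mono) auto
    finally show "1 \<le> t ^ (N ^ v) \<and> t ^ (N ^ v) \<le> b"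
      using t d by (simp add: one_le_power)
  qed
  then have "{1..d} \<subseteq> {t. poly q t = 0}" by auto
  then have "q = 0"
    using d(1) poly_roots_finite[of q] by (metis finite_subset infinite_Icc)
  show "p = 0"
  proof (rule poly_mapping_eqI)
    fix m
    show "Poly_Mapping.lookup p m = Poly_Mapping.lookup 0 m"
    proof (cases "m \<in> Poly_Mapping.keys p")
      case True
      have "coeff q (code m) = (\<Sum>m'\<in>Poly_Mapping.keys p.
          if m' = m then Poly_Mapping.lookup p m' else 0)"
        unfolding q_def coeff_sum
        by (intro sum.cong) (use inj True in \<open>auto simp: inj_on_eq_iff\<close>)
      with \<open>q = 0\<close> True show ?thesis by simp
    qed (simp add: in_keys_iff)
  qed
qed

section \<open>Trigonometric forms\<close>

text \<open>Gaussian elimination, with unknowns indexed by \<open>A\<close> and equations by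
  \<open>B\<close>: an equation with a nonzero coefficient removes one unknown and one
  equation.\<close>

lemma homogeneous_system_nontrivial_solution:
  fixes M :: "'a \<Rightarrow> 'b \<Rightarrow> 'k::field"
  assumes "finite B" "finite A" "card B < card A"
  shows "\<exists>c. (\<exists>a\<in>A. c a \<noteq> 0) \<and> (\<forall>b\<in>B. (\<Sum>a\<in>A. c a * M a b) = 0)"
  using assms
proof (induction B arbitrary: A M rule: finite_induct)
  case empty
  then have "A \<noteq> {}" by auto
  then show ?case by (intro exI[of _ "\<lambda>_. 1"]) auto
next
  case (insert b B)
  show ?case
  proof (cases "\<forall>a\<in>A. M a b = 0")
    case True
    have "card B < card A" using insert by simp
    from insert.IH[OF insert.prems(1) this, of M] obtain c where
      c: "\<exists>a\<in>A. c a \<noteq> 0" "\<forall>b'\<in>B. (\<Sum>a\<in>A. c a * M a b') = 0" by blast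
    moreover have "(\<Sum>a\<in>A. c a * M a b) = 0" using True by simp
    ultimately show ?thesis by (metis insert_iff)
  next
    case False
    then obtain a0 where a0: "a0 \<in> A" "M a0 b \<noteq> 0" by auto
    let ?A = "A - {a0}"
    \<comment> \<open>The system after equation \<open>b\<close> has been solved for the unknown
      \<open>a0\<close>.\<close>
    define M' where "M' a b' = M a b' - M a b / M a0 b * M a0 b'" for a b'
    have "card B < card ?A" "finite ?A" using insert a0 by auto
    from insert.IH[OF this(2,1), of M'] obtain c where
      c: "\<exists>a\<in>?A. c a \<noteq> 0" "\<And>b'. b' \<in> B \<Longrightarrow> (\<Sum>a\<in>?A. c a * M' a b') = 0" by auto
    define d where "d = (\<Sum>a\<in>?A. c a * M a b) / M a0 b"
    define c' where "c' a = (if a = a0 then - d else c a)" for a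
    have sum: "(\<Sum>a\<in>A. c' a * M a b') = - d * M a0 b' + (\<Sum>a\<in>?A. c a * M a b')" for b'
      using insert.prems(1) a0(1) by (simp add: sum.remove[of A a0] c'_def)
    have "(\<Sum>a\<in>A. c' a * M a b') = 0" if "b' \<in> insert b B" for b'
    proof (cases "b' = b")
      case True
      then show ?thesis using a0(2) by (simp add: sum d_def)
    next
      case False
      then have "0 = (\<Sum>a\<in>?A. c a * M' a b')" using c(2) that by auto
      also have "\<dots> = (\<Sum>a\<in>?A. c a * M a b' - c a * M a b / M a0 b * M a0 b')"
        by (intro sum.cong refl) (simp add: M'_def right_diff_distrib)
      also have "\<dots> = (\<Sum>a\<in>?A. c a * M a b') - d * M a0 b'"
        unfolding d_def sum_subtractf sum_divide_distrib sum_distrib_right ..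
      finally show ?thesis by (simp add: sum)
    qed
    moreover have "\<exists>a\<in>A. c' a \<noteq> 0" using c(1) by (auto simp: c'_def)
    ultimately show ?thesis by blast
  qed
qed

section \<open>Spans of finitely many functions\<close>

definition fspan :: "('a \<Rightarrow> real) set \<Rightarrow> ('a \<Rightarrow> real) set" where
  "fspan S = {g. \<exists>c. \<forall>x. g x = (\<Sum>b\<in>S. c b * b x)}"

lemma fspan_superset: "finite S \<Longrightarrow> b \<in> S \<Longrightarrow> b \<in> fspan S"
  unfolding fspan_def
  by (rule CollectI, rule exI[of _ "\<lambda>b'. if b' = b then 1 else 0"])
    (simp add: if_distrib[of "\<lambda>c. c * _"] cong: if_cong)

lemma fspan_0: "(\<lambda>x. 0) \<in> fspan S"
  unfolding fspan_def by (rule CollectI, rule exI[of _ "\<lambda>_. 0"]) simp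

lemma fspan_add: "f \<in> fspan S \<Longrightarrow> g \<in> fspan S \<Longrightarrow> (\<lambda>x. f x + g x) \<in> fspan S"
  unfolding fspan_def
proof safe
  fix c d assume "\<forall>x. f x = (\<Sum>b\<in>S. c b * b x)" "\<forall>x. g x = (\<Sum>b\<in>S. d b * b x)"
  then show "\<exists>c. \<forall>x. f x + g x = (\<Sum>b\<in>S. c b * b x)"
    by (intro exI[of _ "\<lambda>b. c b + d b"]) (simp add: distrib_right sum.distrib)
qed

lemma fspan_scale: "f \<in> fspan S \<Longrightarrow> (\<lambda>x. a * f x) \<in> fspan S"
  unfolding fspan_def
proof safe
  fix c assume "\<forall>x. f x = (\<Sum>b\<in>S. c b * b x)"
  then show "\<exists>c. \<forall>x. a * f x = (\<Sum>b\<in>S. c b * b x)"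
    by (intro exI[of _ "\<lambda>b. a * c b"]) (simp add: sum_distrib_left mult.assoc)
qed

lemma fspan_diff: "f \<in> fspan S \<Longrightarrow> g \<in> fspan S \<Longrightarrow> (\<lambda>x. f x - g x) \<in> fspan S"
  using fspan_add[of f S "\<lambda>x. - 1 * g x"] fspan_scale[of g S "- 1"] by simp

lemma fspan_sum: "(\<And>i. i \<in> I \<Longrightarrow> f i \<in> fspan S) \<Longrightarrow> (\<lambda>x. \<Sum>i\<in>I. f i x) \<in> fspan S"
proof (induction I rule: infinite_finite_induct)
  case (insert i I)
  then show ?case using fspan_add[of "f i" S "\<lambda>x. \<Sum>i\<in>I. f i x"] by simp
qed (auto simp: fspan_0)

lemma fspan_mult:
  assumes "f \<in> fspan S" "g \<in> fspan T"
    and "\<And>s t. s \<in> S \<Longrightarrow> t \<in> T \<Longrightarrow> (\<lambda>x. s x * t x) \<in> fspan U"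
  shows "(\<lambda>x. f x * g x) \<in> fspan U"
proof -
  obtain c d where "\<And>x. f x = (\<Sum>b\<in>S. c b * b x)" "\<And>x. g x = (\<Sum>b\<in>T. d b * b x)"
    using assms(1,2) by (auto simp: fspan_def)
  then have "f x * g x = (\<Sum>s\<in>S. \<Sum>t\<in>T. (c s * d t) * (s x * t x))" for x
    by (simp add: sum_product ac_simps)
  moreover have "(\<lambda>x. \<Sum>s\<in>S. \<Sum>t\<in>T. (c s * d t) * (s x * t x)) \<in> fspan U"
    by (intro fspan_sum fspan_scale assms(3))
  ultimately show ?thesis by presburger
qed

text \<open>The coefficients belong to the indices \<open>e\<close> and not to the functions
  \<open>u e\<close>, so a coincidence \<open>u e = u e'\<close> counts as a relation too. For the
  monomials this matters: they stay distinct as exponent vectors even if their values agree.\<close>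

lemma fspan_linearly_dependent:
  assumes "finite S" "finite E" "card S < card E" "\<And>e. e \<in> E \<Longrightarrow> u e \<in> fspan S"
  shows "\<exists>c. (\<exists>e\<in>E. c e \<noteq> 0) \<and> (\<forall>x. (\<Sum>e\<in>E. c e * u e x) = 0)"
proof -
  have "\<forall>e\<in>E. \<exists>c. \<forall>x. u e x = (\<Sum>b\<in>S. c b * b x)"
    using assms(4) by (simp add: fspan_def)
  then obtain M where M: "\<And>e x. e \<in> E \<Longrightarrow> u e x = (\<Sum>b\<in>S. M e b * b x)"
    by metis
  obtain c where c: "\<exists>e\<in>E. c e \<noteq> 0" "\<And>b. b \<in> S \<Longrightarrow> (\<Sum>e\<in>E. c e * M e b) = 0"
    using homogeneous_system_nontrivial_solution[OF assms(1-3), of M] by auto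
  have "(\<Sum>e\<in>E. c e * u e x) = 0" for x
  proof -
    have "(\<Sum>e\<in>E. c e * u e x) = (\<Sum>e\<in>E. \<Sum>b\<in>S. (c e * M e b) * b x)"
      by (simp add: M sum_distrib_left mult.assoc)
    also have "\<dots> = (\<Sum>b\<in>S. (\<Sum>e\<in>E. c e * M e b) * b x)"
      by (subst sum.swap) (simp add: sum_distrib_right)
    finally show ?thesis using c(2) by simp
  qed
  with c(1) show ?thesis by blast
qed

text \<open>For each angle this is a binary form of degree \<open>2 * N\<close> in the cosine and
  sine of the half angle. Half angles are used because 1, \<open>cos\<close> and \<open>sin\<close>
  of the full angle are all quadratic forms in them.\<close>

definition half_monom :: "nat \<Rightarrow> nat \<Rightarrow> (nat \<Rightarrow> nat) \<Rightarrow> (nat \<Rightarrow> real) \<Rightarrow> real" where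
  "half_monom k N e \<theta> = (\<Prod>v<k. cos (\<theta> v / 2) ^ (2 * N - e v) * sin (\<theta> v / 2) ^ e v)"

definition half_monoms :: "nat \<Rightarrow> nat \<Rightarrow> ((nat \<Rightarrow> real) \<Rightarrow> real) set" where
  "half_monoms k N = half_monom k N ` (PiE {..<k} (\<lambda>_. {..2 * N}))"

text \<open>Homogeneity in the half angles costs nothing, since \<open>cos\<^sup>2 + sin\<^sup>2 = 1\<close> raises degrees, and it
  keeps the dimension at most \<open>(2 * N + 1) ^ k\<close>.\<close>

definition trig_forms :: "nat \<Rightarrow> nat \<Rightarrow> ((nat \<Rightarrow> real) \<Rightarrow> real) set" where
  "trig_forms k N = fspan (half_monoms k N)"

lemma finite_half_monoms: "finite (half_monoms k N)"
  by (simp add: half_monoms_def finite_PiE)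

lemma card_half_monoms: "card (half_monoms k N) \<le> (2 * N + 1) ^ k"
proof -
  have "card (half_monoms k N) \<le> card (PiE {..<k} (\<lambda>_. {..2 * N}))"
    unfolding half_monoms_def by (intro card_image_le finite_PiE) auto
  then show ?thesis by (simp add: card_PiE)
qed

lemma half_monom_in_half_monoms:
  assumes "\<And>v. v < k \<Longrightarrow> e v \<le> 2 * N"
  shows "half_monom k N e \<in> half_monoms k N"
  unfolding half_monoms_def
proof
  show "half_monom k N e = half_monom k N (restrict e {..<k})"
    by (auto simp: half_monom_def)
qed (use assms in auto)

lemma trig_forms_mult:
  assumes "f \<in> trig_forms k M" "g \<in> trig_forms k N"
  shows "(\<lambda>\<theta>. f \<theta> * g \<theta>) \<in> trig_forms k (M + N)"
  unfolding trig_forms_def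
proof (rule fspan_mult[OF assms[unfolded trig_forms_def]])
  fix s t assume "s \<in> half_monoms k M" "t \<in> half_monoms k N"
  then obtain e e' where e: "s = half_monom k M e" "\<And>v. v < k \<Longrightarrow> e v \<le> 2 * M"
    and e': "t = half_monom k N e'" "\<And>v. v < k \<Longrightarrow> e' v \<le> 2 * N"
    by (force simp: half_monoms_def PiE_iff)
  have "s \<theta> * t \<theta> = half_monom k (M + N) (\<lambda>v. e v + e' v) \<theta>" for \<theta>
    unfolding e e' half_monom_def prod.distrib [symmetric]
  proof (rule prod.cong)
    fix v assume "v \<in> {..<k}"
    then have "2 * (M + N) - (e v + e' v) = (2 * M - e v) + (2 * N - e' v)"
      using e(2)[of v] e'(2)[of v] by simp
    then show "cos (\<theta> v / 2) ^ (2 * M - e v) * sin (\<theta> v / 2) ^ e v *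
        (cos (\<theta> v / 2) ^ (2 * N - e' v) * sin (\<theta> v / 2) ^ e' v)
      = cos (\<theta> v / 2) ^ (2 * (M + N) - (e v + e' v)) * sin (\<theta> v / 2) ^ (e v + e' v)"
      by (simp add: power_add)
  qed simp
  then have "(\<lambda>\<theta>. s \<theta> * t \<theta>) = half_monom k (M + N) (\<lambda>v. e v + e' v)" by blast
  moreover have "half_monom k (M + N) (\<lambda>v. e v + e' v) \<in> half_monoms k (M + N)"
    using e(2) e'(2) by (intro half_monom_in_half_monoms) (fastforce intro: add_mono)
  ultimately show "(\<lambda>\<theta>. s \<theta> * t \<theta>) \<in> fspan (half_monoms k (M + N))"
    by (simp add: fspan_superset finite_half_monoms)
qed

lemma trig_forms_0_one: "(\<lambda>\<theta>. 1) \<in> trig_forms k 0"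
proof -
  have "half_monom k 0 (\<lambda>_. 0) \<in> trig_forms k 0"
    unfolding trig_forms_def
    by (intro fspan_superset finite_half_monoms half_monom_in_half_monoms) simp
  then show ?thesis by (simp add: half_monom_def [abs_def])
qed

lemma trig_forms_power: "f \<in> trig_forms k N \<Longrightarrow> (\<lambda>\<theta>. f \<theta> ^ j) \<in> trig_forms k (N * j)"
proof (induction j)
  case (Suc j)
  then show ?case using trig_forms_mult[of f k N "\<lambda>\<theta>. f \<theta> ^ j" "N * j"] by simp
qed (simp add: trig_forms_0_one)

lemma trig_forms_prod_power:
  assumes "\<And>v. v \<in> A \<Longrightarrow> h v \<in> trig_forms k 1"
  shows "(\<lambda>\<theta>. \<Prod>v\<in>A. h v \<theta> ^ e v) \<in> trig_forms k (\<Sum>v\<in>A. e v)"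
  using assms
proof (induction A rule: infinite_finite_induct)
  case (insert v A)
  have "(\<lambda>\<theta>. h v \<theta> ^ e v * (\<Prod>v\<in>A. h v \<theta> ^ e v)) \<in> trig_forms k (1 * e v + (\<Sum>v\<in>A. e v))"
    using insert.prems insert.IH by (intro trig_forms_mult trig_forms_power) auto
  with insert.hyps show ?case by simp
qed (simp_all add: trig_forms_0_one)

text \<open>Adjoining a new angle: by the double angle formulas the new factor is a quadratic form
  in the half angle of \<open>\<theta> k\<close>, and multiplying by it leaves the degrees in the
  old angles alone.\<close>

lemma trig_forms_extend:
  assumes "f \<in> trig_forms k 1" "g = (\<lambda>_. 1) \<or> g = cos \<or> g = sin"
  shows "(\<lambda>\<theta>. f \<theta> * g (\<theta> k)) \<in> trig_forms (Suc k) 1"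
proof -
  define q where "q j = (\<lambda>\<theta> :: nat \<Rightarrow> real. cos (\<theta> k / 2) ^ (2 - j) * sin (\<theta> k / 2) ^ j)" for j
  let ?S = "q ` {..2}"
  have q: "q j \<in> fspan ?S" if "j \<le> 2" for j
    using that by (intro fspan_superset) auto
  have "(\<lambda>\<theta>. 1) = (\<lambda>\<theta>. q 0 \<theta> + q 2 \<theta>)" "(\<lambda>\<theta>. cos (\<theta> k)) = (\<lambda>\<theta>. q 0 \<theta> - q 2 \<theta>)"
    "(\<lambda>\<theta>. sin (\<theta> k)) = (\<lambda>\<theta>. 2 * q 1 \<theta>)"
  proof -
    have "cos (\<theta> k) = cos (\<theta> k / 2) ^ 2 - sin (\<theta> k / 2) ^ 2"
      "sin (\<theta> k) = 2 * (cos (\<theta> k / 2) * sin (\<theta> k / 2))" for \<theta> :: "nat \<Rightarrow> real"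
      using cos_double[of "\<theta> k / 2"] sin_double[of "\<theta> k / 2"] by simp_all
    then show "(\<lambda>\<theta>. 1) = (\<lambda>\<theta>. q 0 \<theta> + q 2 \<theta>)" "(\<lambda>\<theta>. cos (\<theta> k)) = (\<lambda>\<theta>. q 0 \<theta> - q 2 \<theta>)"
      "(\<lambda>\<theta>. sin (\<theta> k)) = (\<lambda>\<theta>. 2 * q 1 \<theta>)"
      by (simp_all add: q_def fun_eq_iff)
  qed
  with assms(2) have g: "(\<lambda>\<theta>. g (\<theta> k)) \<in> fspan ?S"
    by (auto intro!: q fspan_add fspan_diff fspan_scale)
  show ?thesis
    unfolding trig_forms_def
  proof (rule fspan_mult[OF assms(1)[unfolded trig_forms_def] g])
    fix s t assume "s \<in> half_monoms k 1" "t \<in> ?S"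
    then obtain e j where e: "s = half_monom k 1 e" "\<And>v. v < k \<Longrightarrow> e v \<le> 2"
      and j: "t = q j" "j \<le> 2"
      by (force simp: half_monoms_def PiE_iff)
    have "(\<lambda>\<theta>. s \<theta> * t \<theta>) = half_monom (Suc k) 1 (e(k := j))"
      by (simp add: e j half_monom_def q_def fun_eq_iff)
    moreover have "half_monom (Suc k) 1 (e(k := j)) \<in> half_monoms (Suc k) 1"
      by (intro half_monom_in_half_monoms) (use e j in \<open>auto simp: less_Suc_eq\<close>)
    ultimately show "(\<lambda>\<theta>. s \<theta> * t \<theta>) \<in> fspan (half_monoms (Suc k) 1)"
      by (simp add: fspan_superset finite_half_monoms)
  qed
qed

lemma trig_forms_one: "(\<lambda>\<theta>. 1) \<in> trig_forms k 1"
proof (induction k)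
  case 0
  have "half_monom 0 1 (\<lambda>_. 0) \<in> trig_forms 0 1"
    unfolding trig_forms_def
    by (intro fspan_superset finite_half_monoms half_monom_in_half_monoms) simp
  then show ?case by (simp add: half_monom_def [abs_def])
next
  case (Suc k)
  from trig_forms_extend[OF this, of "\<lambda>_. 1"] show ?case by simp
qed

lemma trig_forms_add:
  "f \<in> trig_forms k N \<Longrightarrow> g \<in> trig_forms k N \<Longrightarrow> (\<lambda>\<theta>. f \<theta> + g \<theta>) \<in> trig_forms k N"
  unfolding trig_forms_def by (rule fspan_add)

lemma trig_forms_diff:
  "f \<in> trig_forms k N \<Longrightarrow> g \<in> trig_forms k N \<Longrightarrow> (\<lambda>\<theta>. f \<theta> - g \<theta>) \<in> trig_forms k N"
  unfolding trig_forms_def by (rule fspan_diff)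

text \<open>Cosine and sine are carried together because the addition theorems mix them.
  Intersecting \<open>A\<close> with \<open>{..<k}\<close> lets the induction on \<open>k\<close>
  add one angle or skip it.\<close>

lemma trig_forms_cos_sin_sum:
  "(\<lambda>\<theta>. cos (\<Sum>v\<in>A \<inter> {..<k}. \<theta> v)) \<in> trig_forms k 1 \<and>
   (\<lambda>\<theta>. sin (\<Sum>v\<in>A \<inter> {..<k}. \<theta> v)) \<in> trig_forms k 1"
proof (induction k)
  case 0
  show ?case using trig_forms_one[of 0] by (simp add: trig_forms_def fspan_0)
next
  case (Suc k)
  let ?s = "\<lambda>\<theta>. \<Sum>v\<in>A \<inter> {..<k}. \<theta> v :: real"
  have ext: "(\<lambda>\<theta>. F (?s \<theta>) * g (\<theta> k)) \<in> trig_forms (Suc k) 1"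
    if "F = cos \<or> F = sin" "g = (\<lambda>_. 1) \<or> g = cos \<or> g = sin" for F g
    using that Suc.IH by (intro trig_forms_extend) auto
  show ?case
  proof (cases "k \<in> A")
    case True
    then have "A \<inter> {..<Suc k} = insert k (A \<inter> {..<k})" by auto
    then have "(\<Sum>v\<in>A \<inter> {..<Suc k}. \<theta> v) = ?s \<theta> + \<theta> k" for \<theta> by simp
    moreover have "(\<lambda>\<theta>. cos (?s \<theta>) * cos (\<theta> k) - sin (?s \<theta>) * sin (\<theta> k)) \<in> trig_forms (Suc k) 1"
      "(\<lambda>\<theta>. sin (?s \<theta>) * cos (\<theta> k) + cos (?s \<theta>) * sin (\<theta> k)) \<in> trig_forms (Suc k) 1"
      by (rule trig_forms_diff[OF ext[of cos cos] ext[of sin sin]]; simp)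
        (rule trig_forms_add[OF ext[of sin cos] ext[of cos sin]]; simp)
    ultimately show ?thesis by (simp add: cos_add sin_add)
  next
    case False
    then have "A \<inter> {..<Suc k} = A \<inter> {..<k}" by (auto simp: less_Suc_eq)
    then show ?thesis using ext[of cos "\<lambda>_. 1"] ext[of sin "\<lambda>_. 1"] by simp
  qed
qed

lemma trig_forms_sin_sum: "A \<subseteq> {..<k} \<Longrightarrow> (\<lambda>\<theta>. sin (\<Sum>v\<in>A. \<theta> v)) \<in> trig_forms k 1"
  using trig_forms_cos_sin_sum[of A k] by (simp add: Int_absorb2)

lemma trig_forms_sin: "v < k \<Longrightarrow> (\<lambda>\<theta>. sin (\<theta> v)) \<in> trig_forms k 1"
  using trig_forms_sin_sum[of "{v}" k] by simp

text \<open>Among the \<open>(K + 1) ^ n\<close> monomials of degree \<open>n * K\<close> below there must be a linear relation,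
  since their values lie in a space of dimension \<open>(2 * n * K + 1) ^ m\<close> with \<open>m < n\<close>.\<close>

lemma trig_forms_algebraically_dependent:
  assumes "m < n" and h: "\<And>v. v \<le> n \<Longrightarrow> h v \<in> trig_forms m 1"
  shows "\<exists>p :: mpoly. p \<noteq> 0 \<and> mpoly_vars p \<subseteq> {..n} \<and>
    (\<forall>R \<theta>. mpoly_eval p (\<lambda>v. R * h v \<theta>) = 0)"
proof -
  \<comment> \<open>This value turns \<open>(2 * n * (K + 1)) ^ m\<close> into
    \<open>K * (K + 1) ^ m\<close>, which is just below \<open>(K + 1) ^ Suc m\<close>.\<close>
  define K where "K = (2 * n) ^ m"
  define D where "D = n * K"
  define S where "S = half_monoms m D"
  define E where "E = PiE {..<n} (\<lambda>_. {..K})"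
  have E: "finite E" "card E = (K + 1) ^ n"
    by (simp_all add: E_def finite_PiE card_PiE)
  have "card S \<le> (2 * D + 1) ^ m"
    unfolding S_def by (rule card_half_monoms)
  also have "\<dots> \<le> (2 * n * (K + 1)) ^ m"
    using \<open>m < n\<close> by (intro power_mono) (auto simp: D_def)
  also have "\<dots> = K * (K + 1) ^ m"
    unfolding power_mult_distrib K_def ..
  also have "\<dots> < (K + 1) ^ Suc m" by simp
  also have "\<dots> \<le> (K + 1) ^ n"
    using \<open>m < n\<close> by (intro power_increasing) auto
  finally have card: "card S < card E" using E by simp
  \<comment> \<open>The exponent of the last variable fills the total degree up to \<open>D\<close>.
    All monomials are then of degree \<open>D\<close>, which puts their values into one space of
    forms and lets \<open>R ^ D\<close> factor out.\<close>
  define ex where "ex e v = (if v < n then e v else if v = n then D - (\<Sum>v<n. e v) else 0)"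
    for e :: "nat \<Rightarrow> nat" and v
  define pm where "pm e = Abs_poly_mapping (ex e)" for e
  have lookup_pm: "Poly_Mapping.lookup (pm e) v = ex e v" for e v
  proof -
    have "finite {v. ex e v \<noteq> 0}"
      by (rule finite_subset[of _ "{..n}"]) (auto simp: ex_def split: if_splits)
    then show ?thesis by (simp add: pm_def)
  qed
  have keys_pm: "Poly_Mapping.keys (pm e) \<subseteq> {..n}" for e
    by (auto simp: in_keys_iff lookup_pm ex_def split: if_splits)
  have sum_ex: "(\<Sum>v\<le>n. ex e v) = D" if "e \<in> E" for e
  proof -
    have "(\<Sum>v<n. e v) \<le> (\<Sum>v<n. K)"
      using that by (intro sum_mono) (auto simp: E_def PiE_iff)
    then show ?thesis
      by (simp add: lessThan_Suc_atMost [symmetric] ex_def D_def)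
  qed
  have inj: "inj_on pm E"
  proof (rule inj_onI)
    fix e e' assume *: "e \<in> E" "e' \<in> E" "pm e = pm e'"
    then have "ex e v = ex e' v" for v by (metis lookup_pm)
    then have "e v = e' v" if "v < n" for v using that by (metis ex_def)
    then show "e = e'" using * by (auto simp: E_def intro: PiE_ext)
  qed
  define u where "u e = (\<lambda>\<theta>. \<Prod>v\<le>n. h v \<theta> ^ ex e v)" for e
  have u: "u e \<in> fspan S" if "e \<in> E" for e
    using trig_forms_prod_power[of "{..n}" h m "ex e"] h sum_ex[OF that]
    by (simp add: u_def S_def trig_forms_def)
  obtain c where c: "\<exists>e\<in>E. c e \<noteq> 0" "\<And>\<theta>. (\<Sum>e\<in>E. c e * u e \<theta>) = 0"
    using fspan_linearly_dependent[OF _ E(1) card, of u] u finite_half_monoms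
    unfolding S_def by blast
  define p :: mpoly where
    "p = Abs_poly_mapping (\<lambda>k. if k \<in> pm ` E then c (the_inv_into E pm k) else 0)"
  have "finite {k. (if k \<in> pm ` E then c (the_inv_into E pm k) else 0) \<noteq> 0}"
    by (rule finite_subset[of _ "pm ` E"]) (use E in \<open>auto split: if_splits\<close>)
  then have lookup_p:
    "Poly_Mapping.lookup p k = (if k \<in> pm ` E then c (the_inv_into E pm k) else 0)" for k
    by (simp add: p_def)
  have lookup_p_pm: "Poly_Mapping.lookup p (pm e) = c e" if "e \<in> E" for e
    using that inj by (simp add: lookup_p the_inv_into_f_f)
  have keys_p: "Poly_Mapping.keys p \<subseteq> pm ` E"
    by (auto simp: in_keys_iff lookup_p split: if_splits)
  have "p \<noteq> 0" using c(1) lookup_p_pm by (metis lookup_zero)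
  moreover have "mpoly_vars p \<subseteq> {..n}"
    using keys_p keys_pm unfolding mpoly_vars_def by blast
  moreover have "mpoly_eval p (\<lambda>v. R * h v \<theta>) = 0" for R \<theta>
  proof -
    have "eval_monom (pm e) (\<lambda>v. R * h v \<theta>) = R ^ D * u e \<theta>" if "e \<in> E" for e
      using sum_ex[OF that] eval_monom_superset[OF _ keys_pm, of e "\<lambda>v. R * h v \<theta>"]
      by (simp add: lookup_pm u_def power_mult_distrib prod.distrib power_sum [symmetric])
    then have "mpoly_eval p (\<lambda>v. R * h v \<theta>) = (\<Sum>e\<in>E. c e * (R ^ D * u e \<theta>))"
      using mpoly_eval_superset[OF _ keys_p] E(1) inj
      by (simp add: sum.reindex lookup_p_pm)
    also have "\<dots> = R ^ D * (\<Sum>e\<in>E. c e * u e \<theta>)"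
      by (simp add: sum_distrib_left mult_ac)
    finally show ?thesis using c(2) by simp
  qed
  ultimately show ?thesis by blast
qed

section \<open>Analytic continuation along lines\<close>

text \<open>Entire extensions along single real lines reduce the several-variable problem to one
  complex variable.\<close>

definition line_analytic :: "((nat \<Rightarrow> real) \<Rightarrow> real) \<Rightarrow> bool" where
  "line_analytic f \<longleftrightarrow> (\<forall>x y. \<exists>F. F holomorphic_on UNIV \<and>
     (\<forall>t. F (complex_of_real t) = complex_of_real (f (\<lambda>v. x v + t * (y v - x v)))))"

lemma line_analyticI:
  assumes "\<And>x y. F x y holomorphic_on UNIV"
    "\<And>x y t. F x y (complex_of_real t) = complex_of_real (f (\<lambda>v. x v + t * (y v - x v)))"
  shows "line_analytic f"
  unfolding line_analytic_def using assms by blast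

lemma line_analytic_const: "line_analytic (\<lambda>\<theta>. c)"
  by (rule line_analyticI[of "\<lambda>x y z. of_real c"]) (auto intro!: holomorphic_intros)

lemma line_analytic_proj: "line_analytic (\<lambda>\<theta>. \<theta> v)"
  by (rule line_analyticI[of "\<lambda>x y z. of_real (x v) + z * of_real (y v - x v)"])
    (auto intro!: holomorphic_intros)

lemma line_analytic_cos_half: "line_analytic (\<lambda>\<theta>. cos (\<theta> v / 2))"
  by (rule line_analyticI[of "\<lambda>x y z. cos ((of_real (x v) + z * of_real (y v - x v)) / 2)"])
    (auto intro!: holomorphic_intros simp flip: cos_of_real)

lemma line_analytic_sin_half: "line_analytic (\<lambda>\<theta>. sin (\<theta> v / 2))"
  by (rule line_analyticI[of "\<lambda>x y z. sin ((of_real (x v) + z * of_real (y v - x v)) / 2)"])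
    (auto intro!: holomorphic_intros simp flip: sin_of_real)

lemma line_analytic_add:
  assumes "line_analytic f" "line_analytic g"
  shows "line_analytic (\<lambda>\<theta>. f \<theta> + g \<theta>)"
  unfolding line_analytic_def
proof (intro allI)
  fix x y
  obtain F G where "F holomorphic_on UNIV" "G holomorphic_on UNIV"
    "\<And>t. F (complex_of_real t) = complex_of_real (f (\<lambda>v. x v + t * (y v - x v)))"
    "\<And>t. G (complex_of_real t) = complex_of_real (g (\<lambda>v. x v + t * (y v - x v)))"
    using assms unfolding line_analytic_def by blast
  then show "\<exists>H. H holomorphic_on UNIV \<and> (\<forall>t. H (complex_of_real t) =
      complex_of_real (f (\<lambda>v. x v + t * (y v - x v)) + g (\<lambda>v. x v + t * (y v - x v))))"
    by (intro exI[of _ "\<lambda>z. F z + G z"]) (auto intro!: holomorphic_intros)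
qed

lemma line_analytic_mult:
  assumes "line_analytic f" "line_analytic g"
  shows "line_analytic (\<lambda>\<theta>. f \<theta> * g \<theta>)"
  unfolding line_analytic_def
proof (intro allI)
  fix x y
  obtain F G where "F holomorphic_on UNIV" "G holomorphic_on UNIV"
    "\<And>t. F (complex_of_real t) = complex_of_real (f (\<lambda>v. x v + t * (y v - x v)))"
    "\<And>t. G (complex_of_real t) = complex_of_real (g (\<lambda>v. x v + t * (y v - x v)))"
    using assms unfolding line_analytic_def by blast
  then show "\<exists>H. H holomorphic_on UNIV \<and> (\<forall>t. H (complex_of_real t) =
      complex_of_real (f (\<lambda>v. x v + t * (y v - x v)) * g (\<lambda>v. x v + t * (y v - x v))))"
    by (intro exI[of _ "\<lambda>z. F z * G z"]) (auto intro!: holomorphic_intros)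
qed

lemma line_analytic_power: "line_analytic f \<Longrightarrow> line_analytic (\<lambda>\<theta>. f \<theta> ^ j)"
  by (induction j) (auto intro: line_analytic_const line_analytic_mult)

lemma line_analytic_sum:
  "(\<And>i. i \<in> I \<Longrightarrow> line_analytic (f i)) \<Longrightarrow> line_analytic (\<lambda>\<theta>. \<Sum>i\<in>I. f i \<theta>)"
  by (induction I rule: infinite_finite_induct) (auto intro: line_analytic_const line_analytic_add)

lemma line_analytic_prod:
  "(\<And>i. i \<in> I \<Longrightarrow> line_analytic (f i)) \<Longrightarrow> line_analytic (\<lambda>\<theta>. \<Prod>i\<in>I. f i \<theta>)"
  by (induction I rule: infinite_finite_induct) (auto intro: line_analytic_const line_analytic_mult)

lemma line_analytic_trig_forms:
  assumes "f \<in> trig_forms k N"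
  shows "line_analytic f"
proof -
  have "line_analytic (half_monom k N e)" for e
    unfolding half_monom_def [abs_def]
    by (intro line_analytic_prod line_analytic_mult line_analytic_power
        line_analytic_cos_half line_analytic_sin_half)
  then have "line_analytic b" if "b \<in> half_monoms k N" for b
    using that unfolding half_monoms_def by blast
  moreover obtain c where "f = (\<lambda>\<theta>. \<Sum>b\<in>half_monoms k N. c b * b \<theta>)"
    using assms unfolding trig_forms_def fspan_def by auto
  ultimately show ?thesis
    by (simp add: line_analytic_sum line_analytic_mult line_analytic_const)
qed

lemma line_analytic_mpoly_eval:
  "(\<And>v. v \<in> mpoly_vars p \<Longrightarrow> line_analytic (f v)) \<Longrightarrow> line_analytic (\<lambda>\<theta>. mpoly_eval p (\<lambda>v. f v \<theta>))"
  unfolding mpoly_eval_def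
  by (intro line_analytic_sum line_analytic_mult line_analytic_const line_analytic_prod
      line_analytic_power) (auto simp: mpoly_vars_def)

text \<open>Join a point where \<open>f\<close> is nonzero to a point where \<open>g\<close> is
  nonzero. On this line \<open>f\<close> stays nonzero near the first point, so \<open>g\<close>
  vanishes on a short interval there and, by the identity theorem, at the second point as
  well.\<close>

lemma line_analytic_no_zero_divisors:
  assumes f: "line_analytic f" and g: "line_analytic g" and fg: "\<And>\<theta>. f \<theta> * g \<theta> = 0"
  shows "(\<forall>\<theta>. f \<theta> = 0) \<or> (\<forall>\<theta>. g \<theta> = 0)"
proof (rule ccontr)
  assume "\<not> ?thesis"
  then obtain x y where x: "f x \<noteq> 0" and y: "g y \<noteq> 0" by auto
  let ?l = "\<lambda>t v. x v + t * (y v - x v)"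
  obtain F G where F: "F holomorphic_on UNIV" "\<And>t. F (complex_of_real t) = of_real (f (?l t))"
    and G: "G holomorphic_on UNIV" "\<And>t. G (complex_of_real t) = of_real (g (?l t))"
    using f g unfolding line_analytic_def by blast
  have F0: "F 0 \<noteq> 0" using F(2)[of 0] x by simp
  have "continuous (at 0) F"
    using F(1) holomorphic_on_imp_continuous_on continuous_on_eq_continuous_at by blast
  from continuous_at_avoid[OF this F0] obtain e where
    e: "e > 0" "\<And>z. dist 0 z < e \<Longrightarrow> F z \<noteq> 0" by auto
  let ?U = "complex_of_real ` {0<..<e}"
  have "G 1 = 0"
  proof (rule analytic_continuation[OF G(1) open_UNIV connected_UNIV subset_UNIV UNIV_I])
    show "0 islimpt ?U"
      unfolding islimpt_approachable
    proof (intro allI impI)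
      fix d :: real assume "d > 0"
      then show "\<exists>z\<in>?U. z \<noteq> 0 \<and> dist z 0 < d"
        using e(1) by (intro bexI[of _ "of_real (min d e / 2)"] conjI imageI) auto
    qed
    fix z assume "z \<in> ?U"
    then obtain t where t: "z = of_real t" "0 < t" "t < e" by auto
    then have "f (?l t) \<noteq> 0" using e(2)[of z] F(2)[of t] by auto
    then show "G z = 0" using fg[of "?l t"] G(2)[of t] t by auto
  qed auto
  then show False using y G(2)[of 1] by simp
qed

text \<open>The scale \<open>R\<close> is stored as the coordinate \<open>\<theta> n\<close>, on which the forms \<open>h v\<close> do not depend.\<close>

lemma trig_forms_irreducible_relation:
  assumes "m < n" and h: "\<And>v. h v \<in> trig_forms m 1"
    and "1 < b"
    and box: "\<And>a. (\<And>v. v < n \<Longrightarrow> 1 \<le> a v \<and> a v \<le> b) \<Longrightarrow> \<exists>\<theta>. \<forall>v<n. a v = \<theta> n * h v \<theta>"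
  shows "\<exists>p. irreducible p \<and> mpoly_vars p \<subseteq> {..n} \<and> n \<in> mpoly_vars p \<and>
    (\<forall>\<theta>. mpoly_eval p (\<lambda>v. \<theta> n * h v \<theta>) = 0)"
proof -
  define X where "X = range (\<lambda>\<theta> v. \<theta> n * h v \<theta>)"
  have "\<exists>p. irreducible p \<and> mpoly_vars p \<subseteq> {..n} \<and> (\<forall>x\<in>X. mpoly_eval p x = 0)"
  proof (rule irreducible_vanishing_polynomial)
    show "X \<noteq> {}" by (simp add: X_def)
    show "\<exists>p. p \<noteq> 0 \<and> mpoly_vars p \<subseteq> {..n} \<and> (\<forall>x\<in>X. mpoly_eval p x = 0)"
      using trig_forms_algebraically_dependent[OF \<open>m < n\<close>, of h] h by (force simp: X_def)
    fix p q :: mpoly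
    have la: "line_analytic (\<lambda>\<theta>. mpoly_eval p (\<lambda>v. \<theta> n * h v \<theta>))" for p
      by (intro line_analytic_mpoly_eval line_analytic_mult line_analytic_proj
          line_analytic_trig_forms[OF h])
    assume "\<forall>x\<in>X. mpoly_eval (p * q) x = 0"
    then show "(\<forall>x\<in>X. mpoly_eval p x = 0) \<or> (\<forall>x\<in>X. mpoly_eval q x = 0)"
      using line_analytic_no_zero_divisors[OF la[of p] la[of q]]
      by (simp add: X_def mpoly_eval_mult)
  qed
  then obtain p where p: "irreducible p" "mpoly_vars p \<subseteq> {..n}" "\<forall>x\<in>X. mpoly_eval p x = 0"
    by blast
  have "n \<in> mpoly_vars p"
  proof (rule ccontr)
    assume "n \<notin> mpoly_vars p"
    with p(2) have vars: "mpoly_vars p \<subseteq> {..<n}"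
      by (metis atMost_iff lessThan_iff order_le_imp_less_or_eq subset_iff)
    have "p = 0"
    proof (rule mpoly_eq_0_if_vanishes_on_box[OF vars \<open>1 < b\<close>])
      fix a :: "nat \<Rightarrow> real" assume "\<And>v. v < n \<Longrightarrow> 1 \<le> a v \<and> a v \<le> b"
      from box[of a, OF this] obtain \<theta> where \<theta>: "\<forall>v<n. a v = \<theta> n * h v \<theta>" by auto
      have "mpoly_eval p a = mpoly_eval p (\<lambda>v. \<theta> n * h v \<theta>)"
        by (rule mpoly_eval_cong) (use vars \<theta> in auto)
      also have "\<dots> = 0" using p(3) by (auto simp: X_def)
      finally show "mpoly_eval p a = 0" .
    qed
    with p(1) show False by simp
  qed
  with p show ?thesis by (auto simp: X_def)
qed

text \<open>This is what permits overwriting the coordinate \<open>\<theta> n\<close> by the scale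
  without changing the values of the forms.\<close>

lemma trig_forms_cong:
  assumes "f \<in> trig_forms k N" "\<And>v. v < k \<Longrightarrow> x v = y v"
  shows "f x = f y"
proof -
  have "b x = b y" if "b \<in> half_monoms k N" for b
    using that assms(2) by (auto simp: half_monoms_def half_monom_def)
  moreover obtain c where "\<And>x. f x = (\<Sum>b\<in>half_monoms k N. c b * b x)"
    using assms(1) by (auto simp: trig_forms_def fspan_def)
  ultimately show ?thesis by (auto intro!: sum.cong)
qed

text \<open>Intermediate value theorem in the reciprocal radius \<open>\<rho>\<close>. The bound
  \<open>10 / 11\<close> keeps every \<open>a v * \<rho>\<close> at most 1. It also exceeds
  \<open>sqrt 3 / 2\<close>, so at \<open>\<rho> = 10 / 11\<close> each of the at least three
  arcsines is at least \<open>pi / 3\<close>; this is what allows the box to reach up to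
  \<open>11 / 10\<close>.\<close>

lemma cyclic_angles_exist:
  fixes a :: "nat \<Rightarrow> real"
  assumes n: "n \<ge> 3" and a: "\<And>v. v < n \<Longrightarrow> 1 \<le> a v \<and> a v \<le> 11 / 10"
  obtains R \<theta> where "(\<Sum>v<n. \<theta> v) = pi" "\<And>v. v < n \<Longrightarrow> a v = R * sin (\<theta> v)"
proof -
  define g where "g \<rho> = (\<Sum>v<n. arcsin (a v * \<rho>))" for \<rho>
  have range: "0 \<le> a v * \<rho>" "a v * \<rho> \<le> 1" if "v < n" "0 \<le> \<rho>" "\<rho> \<le> 10 / 11" for v \<rho>
  proof -
    have "a v * \<rho> \<le> 11 / 10 * (10 / 11)"
      using a[OF that(1)] that by (intro mult_mono) auto
    then show "a v * \<rho> \<le> 1" by simp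
    show "0 \<le> a v * \<rho>" using a[OF that(1)] that by simp
  qed
  have "g 0 \<le> pi" by (simp add: g_def)
  moreover have "pi \<le> g (10 / 11)"
  proof -
    have "sqrt 3 \<le> 20 / 11"
      by (rule real_le_lsqrt) (simp_all add: power2_eq_square)
    have "pi / 3 \<le> arcsin (a v * (10 / 11))" if "v < n" for v
    proof -
      have "sqrt 3 / 2 \<le> a v * (10 / 11)"
        using \<open>sqrt 3 \<le> 20 / 11\<close> a[OF that] by simp
      then have "arcsin (sqrt 3 / 2) \<le> arcsin (a v * (10 / 11))"
        using range[OF that, of "10 / 11"] by (intro arcsin_le_arcsin) (auto intro: order_trans[of _ 0])
      moreover have "arcsin (sin (pi / 3)) = pi / 3"
        using pi_gt_zero by (intro arcsin_sin) (linarith, simp)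
      ultimately show ?thesis by (simp add: sin_60)
    qed
    then have "(\<Sum>v<n. pi / 3) \<le> g (10 / 11)"
      unfolding g_def by (intro sum_mono) auto
    moreover have "(\<Sum>v<n. pi / 3) = real n * (pi / 3)" by simp
    moreover have "3 * (pi / 3) \<le> real n * (pi / 3)"
      using n by (intro mult_right_mono) auto
    ultimately show ?thesis by linarith
  qed
  moreover have "continuous_on {0..10 / 11} g"
    unfolding g_def
    by (intro continuous_intros) (use range in \<open>fastforce intro: order_trans[of _ 0]\<close>)+
  ultimately obtain \<rho> where \<rho>: "0 \<le> \<rho>" "\<rho> \<le> 10 / 11" "g \<rho> = pi"
    using IVT'[of g 0 pi "10 / 11"] by auto
  have "\<rho> \<noteq> 0" using \<rho>(3) by (auto simp: g_def)
  show thesis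
  proof
    show "(\<Sum>v<n. arcsin (a v * \<rho>)) = pi" using \<rho>(3) by (simp add: g_def)
    show "a v = 1 / \<rho> * sin (arcsin (a v * \<rho>))" if "v < n" for v
      using range[OF that \<rho>(1,2)] \<open>\<rho> \<noteq> 0\<close> by (subst sin_arcsin) auto
  qed
qed

lemma cyclic_irreducible_relation:
  assumes n: "n \<ge> 3" and g: "g \<in> trig_forms (n - 1) 1"
  shows "\<exists>p. irreducible p \<and> mpoly_vars p \<subseteq> {..n} \<and> n \<in> mpoly_vars p \<and>
    (\<forall>R \<theta>. (\<Sum>k<n. \<theta> k) = pi \<longrightarrow>
      mpoly_eval p (\<lambda>v. if v < n then R * sin (\<theta> v) else R * g \<theta>) = 0)"
proof -
  \<comment> \<open>Only n - 1 angles are free. The last one is pi minus their sum, which has the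
    same sine as the sum itself. The index \<open>n\<close> carries the value
    \<open>g\<close>.\<close>
  define h where "h v = (if v < n - 1 then (\<lambda>\<theta>. sin (\<theta> v)) else
    if v = n - 1 then (\<lambda>\<theta>. sin (\<Sum>k<n - 1. \<theta> k)) else g)" for v
  have h: "h v \<in> trig_forms (n - 1) 1" for v
    using g trig_forms_sin[of v "n - 1"] trig_forms_sin_sum[of "{..<n - 1}" "n - 1"]
    by (simp add: h_def)
  have last: "sin (\<Sum>k<n - 1. \<theta> k) = sin (\<theta> (n - 1))" if "(\<Sum>k<n. \<theta> k) = pi" for \<theta>
  proof -
    have "(\<Sum>k<n. \<theta> k) = (\<Sum>k<n - 1. \<theta> k) + \<theta> (n - 1)"
      using n by (cases n) auto
    then have "(\<Sum>k<n - 1. \<theta> k) = pi - \<theta> (n - 1)" using that by simp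
    then show ?thesis by simp
  qed
  have val: "h v (\<theta>(n := R)) = (if v < n then sin (\<theta> v) else g \<theta>)"
    if "(\<Sum>k<n. \<theta> k) = pi" for v \<theta> R
  proof -
    have "g (\<theta>(n := R)) = g \<theta>"
      by (rule trig_forms_cong[OF g]) auto
    moreover have "(\<Sum>k<n - 1. (\<theta>(n := R)) k) = (\<Sum>k<n - 1. \<theta> k)"
      by (rule sum.cong) auto
    ultimately show ?thesis
      using last[OF that] n by (auto simp: h_def)
  qed
  have "\<exists>p. irreducible p \<and> mpoly_vars p \<subseteq> {..n} \<and> n \<in> mpoly_vars p \<and>
    (\<forall>\<theta>. mpoly_eval p (\<lambda>v. \<theta> n * h v \<theta>) = 0)"
  proof (rule trig_forms_irreducible_relation[of "n - 1" n h "11 / 10"])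
    fix a :: "nat \<Rightarrow> real"
    assume "\<And>v. v < n \<Longrightarrow> 1 \<le> a v \<and> a v \<le> 11 / 10"
    from cyclic_angles_exist[OF n, of a, OF this] obtain R \<theta>
      where "(\<Sum>v<n. \<theta> v) = pi" "\<And>v. v < n \<Longrightarrow> a v = R * sin (\<theta> v)" by blast
    then show "\<exists>\<theta>. \<forall>v<n. a v = \<theta> n * h v \<theta>"
      by (intro exI[of _ "\<theta>(n := R)"]) (simp add: val)
  qed (use n h in auto)
  then obtain p where p: "irreducible p" "mpoly_vars p \<subseteq> {..n}" "n \<in> mpoly_vars p"
    "\<And>\<theta>. mpoly_eval p (\<lambda>v. \<theta> n * h v \<theta>) = 0" by blast
  have "mpoly_eval p (\<lambda>v. if v < n then R * sin (\<theta> v) else R * g \<theta>) = 0"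
    if "(\<Sum>k<n. \<theta> k) = pi" for R \<theta>
  proof -
    have "(\<lambda>v. if v < n then R * sin (\<theta> v) else R * g \<theta>) =
        (\<lambda>v. (\<theta>(n := R)) n * h v (\<theta>(n := R)))"
      by (auto simp: val[OF that])
    then show ?thesis using p(4)[of "\<theta>(n := R)"] by simp
  qed
  with p show ?thesis by blast
qed

section \<open>Inscribed polygons\<close>

text \<open>In \<open>sin S * cos b + cos S * sin b\<close>, passing to the smaller angles raises
  the cosines, the one of \<open>b\<close> strictly, while the sines lose at most the factor
  \<open>l\<close>.\<close>

lemma sin_add_greater:
  fixes S S' b b' l :: real
  assumes "0 < l" "0 < S'" "S' \<le> S" "0 < b'" "b' < b" "b \<le> pi / 2" "S + b \<le> pi"
    and "sin S' \<ge> l * sin S" "sin b' = l * sin b"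
  shows "sin (S' + b') > l * sin (S + b)"
proof -
  have cb: "cos b < cos b'" "0 \<le> cos b'"
    using assms by (auto intro!: cos_monotone_0_pi cos_ge_zero)
  have cS: "cos S \<le> cos S'"
    using assms by (intro cos_monotone_0_pi_le) auto
  have sS: "0 < sin S" and sb: "0 < sin b"
    using assms by (auto intro!: sin_gt_zero)
  have "l * sin (S + b) = (l * sin S) * cos b + l * (cos S * sin b)"
    by (simp add: sin_add algebra_simps)
  also have "\<dots> < (l * sin S) * cos b' + l * (cos S * sin b)"
    using cb(1) sS \<open>0 < l\<close> by simp
  also have "\<dots> \<le> sin S' * cos b' + l * (cos S' * sin b)"
    using assms(8) cb(2) cS sb \<open>0 < l\<close> by (intro add_mono mult_left_mono mult_right_mono) auto
  also have "\<dots> = sin (S' + b')"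
    using assms(9) by (simp add: sin_add)
  finally show ?thesis .
qed

text \<open>Angles are added one at a time, and each addition makes the inequality strict. A single
  angle gives equality, so the induction carries the weak inequality and strictness is claimed from
  two angles on.\<close>

lemma sin_sum_greater:
  fixes \<theta> \<theta>' :: "'a \<Rightarrow> real"
  assumes "finite A" "A \<noteq> {}" "0 < l"
    and "\<And>k. k \<in> A \<Longrightarrow> 0 < \<theta>' k \<and> \<theta>' k < \<theta> k \<and> \<theta> k \<le> pi / 2"
    and "\<And>k. k \<in> A \<Longrightarrow> sin (\<theta>' k) = l * sin (\<theta> k)"
    and "sum \<theta> A \<le> pi"
  shows "sin (sum \<theta>' A) \<ge> l * sin (sum \<theta> A) \<and>
    (card A \<noteq> 1 \<longrightarrow> sin (sum \<theta>' A) > l * sin (sum \<theta> A))"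
  using assms
proof (induction A rule: finite_ne_induct)
  case (insert k A)
  have pos: "0 < \<theta>' k" "\<theta>' k < \<theta> k" "\<theta> k \<le> pi / 2"
    using insert.prems(2)[of k] by auto
  have sum: "sum \<theta> (insert k A) = sum \<theta> A + \<theta> k" "sum \<theta>' (insert k A) = sum \<theta>' A + \<theta>' k"
    using insert.hyps by simp_all
  have "sin (sum \<theta>' A + \<theta>' k) > l * sin (sum \<theta> A + \<theta> k)"
  proof (rule sin_add_greater)
    show "0 < sum \<theta>' A" using insert.hyps insert.prems by (intro sum_pos) auto
    show "sum \<theta>' A \<le> sum \<theta> A" using insert.prems by (intro sum_mono) (auto intro: less_imp_le)
    show "sum \<theta> A + \<theta> k \<le> pi" using insert.prems(4) sum by simp
    show "l * sin (sum \<theta> A) \<le> sin (sum \<theta>' A)"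
      using insert.IH insert.prems pos sum by auto
  qed (use pos insert.prems in auto)
  then show ?case by (simp add: sum)
qed auto

text \<open>The angle \<open>\<theta> k\<close> is half the central angle over side
  \<open>k\<close>, so the total pi says that the vertices go round the circle exactly once.\<close>

definition cyclic_angles :: "nat \<Rightarrow> real \<Rightarrow> (nat \<Rightarrow> real) \<Rightarrow> bool" where
  "cyclic_angles n R \<theta> \<longleftrightarrow> R > 0 \<and> (\<forall>k<n. \<theta> k > 0) \<and> (\<Sum>k<n. \<theta> k) = pi"

lemma cyclic_angles_two_less_pi:
  assumes "cyclic_angles n R \<theta>" "n \<ge> 3" "i < n" "k < n" "i \<noteq> k"
  shows "\<theta> i + \<theta> k < pi"
proof -
  have "\<not> {..<n} \<subseteq> {i, k}"
    using assms card_mono[of "{i, k}" "{..<n}"] by auto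
  then obtain l where l: "l < n" "l \<noteq> i" "l \<noteq> k" by auto
  have "sum \<theta> {i, k, l} \<le> sum \<theta> {..<n}"
    using assms l by (intro sum_mono2) (auto simp: cyclic_angles_def less_imp_le)
  moreover have "\<theta> l > 0" using assms l by (auto simp: cyclic_angles_def)
  ultimately show ?thesis using assms l by (auto simp: cyclic_angles_def)
qed

text \<open>Otherwise \<open>pi - \<theta> k\<close> would be at most \<open>pi / 2\<close> and
  larger than \<open>\<theta> i\<close>, so side \<open>k\<close> would be longer than side
  \<open>i\<close>. Applied to a longest side \<open>i\<close>, it leaves all other angles acute,
  hence determined by their sines.\<close>

lemma cyclic_angles_acute:
  assumes "cyclic_angles n R \<theta>" "n \<ge> 3" "i < n" "k < n" "i \<noteq> k" "sin (\<theta> k) \<le> sin (\<theta> i)"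
  shows "\<theta> k < pi / 2"
proof (rule ccontr)
  assume "\<not> \<theta> k < pi / 2"
  moreover have "\<theta> i + \<theta> k < pi" "\<theta> i > 0"
    using assms cyclic_angles_two_less_pi[of n R \<theta> i k] by (auto simp: cyclic_angles_def)
  ultimately have "sin (\<theta> i) < sin (pi - \<theta> k)"
    by (intro sin_monotone_2pi) auto
  with assms(6) show False by simp
qed

text \<open>On a larger circle all angles except that of the longest side \<open>i\<close> shrink,
  because they are acute. The sum of these others is pi minus the angle of \<open>i\<close>, so
  \<open>sin_sum_greater\<close> makes the sine at \<open>i\<close> too large for the prescribed
  side. Whether the angle of \<open>i\<close> itself is acute or obtuse never enters.\<close>

lemma cyclic_angles_radius_le:
  assumes \<theta>: "cyclic_angles n R \<theta>" and \<theta>': "cyclic_angles n R' \<theta>'" and n: "n \<ge> 3"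
    and eq: "\<And>k. k < n \<Longrightarrow> R * sin (\<theta> k) = R' * sin (\<theta>' k)"
    and i: "i < n" "\<And>k. k < n \<Longrightarrow> sin (\<theta> k) \<le> sin (\<theta> i)" "\<And>k. k < n \<Longrightarrow> sin (\<theta>' k) \<le> sin (\<theta>' i)"
  shows "R' \<le> R"
proof (rule ccontr)
  assume "\<not> R' \<le> R"
  then have R: "0 < R" "R < R'" using \<theta> by (auto simp: cyclic_angles_def)
  define l where "l = R / R'"
  have l: "0 < l" "l < 1" using R by (auto simp: l_def)
  have sin': "sin (\<theta>' k) = l * sin (\<theta> k)" if "k < n" for k
    using eq[OF that] R by (simp add: l_def field_simps)
  let ?A = "{..<n} - {i}"
  have pos: "0 < \<theta> k" "0 < \<theta>' k" if "k < n" for k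
    using that \<theta> \<theta>' by (auto simp: cyclic_angles_def)
  have sums: "sum \<theta> ?A = pi - \<theta> i" "sum \<theta>' ?A = pi - \<theta>' i"
    using \<theta> \<theta>' i(1) by (auto simp: cyclic_angles_def sum_diff1)
  have "card ?A = n - 1" using i(1) by simp
  then have card: "card ?A \<noteq> 1" "card ?A \<noteq> 0" using n by simp_all
  then have ne: "?A \<noteq> {}" by (metis card.empty)
  have "sin (sum \<theta>' ?A) > l * sin (sum \<theta> ?A)"
  proof (rule sin_sum_greater[THEN conjunct2, rule_format])
    fix k assume k: "k \<in> ?A"
    then have acute: "\<theta> k < pi / 2" "\<theta>' k < pi / 2"
      using cyclic_angles_acute[OF \<theta> n i(1)] cyclic_angles_acute[OF \<theta>' n i(1)] i by auto
    have "0 < sin (\<theta> k)"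
      using pos[of k] acute k by (intro sin_gt_zero) auto
    then have "sin (\<theta>' k) < sin (\<theta> k)"
      using sin'[of k] l k by simp
    then have "\<theta>' k < \<theta> k"
      using acute pos[of k] k by (subst (asm) sin_mono_less_eq) auto
    then show "0 < \<theta>' k \<and> \<theta>' k < \<theta> k \<and> \<theta> k \<le> pi / 2"
      using acute pos k by auto
    show "sin (\<theta>' k) = l * sin (\<theta> k)" using sin' k by simp
  next
    show "sum \<theta> ?A \<le> pi" using pos(1)[OF i(1)] sums by simp
  qed (use l card ne in auto)
  then show False using sin'[OF i(1)] by (simp add: sums)
qed

text \<open>Both angle sequences have the same longest side, so the radius comparison works in both
  directions. The acute angles follow from their sines, and the remaining one from the total
  pi.\<close>

lemma cyclic_angles_unique:
  assumes \<theta>: "cyclic_angles n R \<theta>" and \<theta>': "cyclic_angles n R' \<theta>'" and n: "n \<ge> 3"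
    and eq: "\<And>k. k < n \<Longrightarrow> R * sin (\<theta> k) = R' * sin (\<theta>' k)"
  shows "R = R' \<and> (\<forall>k<n. \<theta> k = \<theta>' k)"
proof -
  have R: "0 < R" "0 < R'" using \<theta> \<theta>' by (auto simp: cyclic_angles_def)
  let ?M = "Max ((\<lambda>k. R * sin (\<theta> k)) ` {..<n})"
  have "?M \<in> (\<lambda>k. R * sin (\<theta> k)) ` {..<n}"
    using n by (intro Max_in) (auto simp: lessThan_empty_iff)
  then obtain i where i: "i < n" "R * sin (\<theta> i) = ?M" by auto
  have max: "R * sin (\<theta> k) \<le> R * sin (\<theta> i)" if "k < n" for k
    unfolding i(2) using that by (intro Max_ge) auto
  have max1: "sin (\<theta> k) \<le> sin (\<theta> i)" if "k < n" for k
    using max[OF that] R by simp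
  have max2: "sin (\<theta>' k) \<le> sin (\<theta>' i)" if "k < n" for k
    using max[OF that] R eq[OF that] eq[OF i(1)] by simp
  have RR: "R = R'"
    using cyclic_angles_radius_le[OF \<theta> \<theta>' n eq i(1) max1 max2]
      cyclic_angles_radius_le[OF \<theta>' \<theta> n eq[symmetric] i(1) max2 max1] by simp
  have same: "\<theta> k = \<theta>' k" if "k < n" "k \<noteq> i" for k
  proof (rule sin_inj_pi)
    have "\<theta> k < pi / 2" "\<theta>' k < pi / 2"
      using cyclic_angles_acute[OF \<theta> n i(1)] cyclic_angles_acute[OF \<theta>' n i(1)] max1 max2 that by auto
    moreover have "\<theta> k > 0" "\<theta>' k > 0" using \<theta> \<theta>' that by (auto simp: cyclic_angles_def)
    ultimately show "- (pi / 2) \<le> \<theta> k" "\<theta> k \<le> pi / 2" "- (pi / 2) \<le> \<theta>' k" "\<theta>' k \<le> pi / 2"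
      by auto
    show "sin (\<theta> k) = sin (\<theta>' k)" using eq[OF that(1)] RR R by simp
  qed
  have "sum \<theta> ({..<n} - {i}) = sum \<theta>' ({..<n} - {i})"
    using same by (intro sum.cong) auto
  then have "\<theta> i = \<theta>' i"
    using \<theta> \<theta>' i(1) by (simp add: cyclic_angles_def sum_diff1)
  with same RR show ?thesis by metis
qed

section \<open>Orientation and crossing of chords of the unit circle\<close>

text \<open>Half the distance between the points at angles \<open>a\<close> and \<open>b\<close>,
  with a sign.\<close>

definition half_chord :: "real \<Rightarrow> real \<Rightarrow> real" where
  "half_chord a b = sin ((b - a) / 2)"

text \<open>Half the signed area of the inscribed triangle, as \<open>orient_eq_area\<close> shows.
  The product form makes its sign computable from the order of the angles.\<close>

definition orient :: "real \<Rightarrow> real \<Rightarrow> real \<Rightarrow> real" where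
  "orient a b c = half_chord a b * half_chord b c * half_chord a c"

lemma half_chord_commute: "half_chord b a = - half_chord a b"
  unfolding half_chord_def sin_minus [symmetric] minus_divide_left minus_diff_eq ..

lemma orient_rotate: "orient b c a = orient a b c"
  unfolding orient_def half_chord_commute[of c a] half_chord_commute[of b a] by simp

lemma orient_eq_area:
  "4 * orient a b c = (cos b - cos a) * (sin c - sin a) - (sin b - sin a) * (cos c - cos a)"
proof -
  have diff: "cos y - cos x = - 2 * sin ((x + y) / 2) * half_chord x y"
    "sin y - sin x = 2 * cos ((x + y) / 2) * half_chord x y" for x y
  proof -
    have "cos y - cos x = 2 * sin ((x + y) / 2) * half_chord y x"
      unfolding half_chord_def cos_diff_cos by (simp add: add.commute)
    then show "cos y - cos x = - 2 * sin ((x + y) / 2) * half_chord x y"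
      by (simp add: half_chord_commute[of x y])
    show "sin y - sin x = 2 * cos ((x + y) / 2) * half_chord x y"
      unfolding half_chord_def sin_diff_sin by (simp add: add.commute)
  qed
  have "(c - b) / 2 = (a + c) / 2 - (a + b) / 2"
    by (simp add: field_simps)
  then have "half_chord b c = sin ((a + c) / 2) * cos ((a + b) / 2)
      - cos ((a + c) / 2) * sin ((a + b) / 2)"
    by (simp only: half_chord_def sin_diff)
  then show ?thesis
    unfolding orient_def diff by (simp only:) (simp add: algebra_simps)
qed

definition chords_cross :: "real \<Rightarrow> real \<Rightarrow> real \<Rightarrow> real \<Rightarrow> bool" where
  "chords_cross a b c d \<longleftrightarrow> (\<exists>t s. 0 < t \<and> t < 1 \<and> 0 < s \<and> s < 1 \<and>
     t * cos a + (1 - t) * cos b = s * cos c + (1 - s) * cos d \<and>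
     t * sin a + (1 - t) * sin b = s * sin c + (1 - s) * sin d)"

text \<open>For general segments each would have to separate the endpoints of the other. On a circle
  one separation implies the other, since the product of the four orientations is a square.\<close>

lemma chords_cross_if_separated:
  assumes "orient a b c * orient a b d < 0"
  shows "chords_cross a b c d"
proof -
  define area where "area a b c = (cos b - cos a) * (sin c - sin a) - (sin b - sin a) * (cos c - cos a)"
    for a b c :: real
  have area: "area a b c = 4 * orient a b c" for a b c
    by (simp add: area_def orient_eq_area)
  have "orient c d a * orient c d b * (orient a b c * orient a b d)
      = (half_chord a b * half_chord c d * half_chord a c * half_chord a d * half_chord b c
          * half_chord b d)\<^sup>2"
    unfolding orient_def half_chord_commute[of c a] half_chord_commute[of d a]
      half_chord_commute[of c b] half_chord_commute[of d b]
      half_chord_commute[of b a] half_chord_commute[of d c]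
    by (simp add: power2_eq_square)
  \<comment> \<open>If \<open>c\<close> and \<open>d\<close> gave the same point, the two
    orientations in the hypothesis would agree and their product could not be negative.\<close>
  moreover have "half_chord c d \<noteq> 0"
  proof
    assume "half_chord c d = 0"
    then have "4 * orient a b c = 4 * orient a b d"
      unfolding orient_eq_area half_chord_def
      using cos_diff_cos[of c d] sin_diff_sin[of d c] by auto
    with assms show False by (auto simp: mult_less_0_iff)
  qed
  moreover have "half_chord a b \<noteq> 0" "half_chord a c \<noteq> 0" "half_chord a d \<noteq> 0"
    "half_chord b c \<noteq> 0" "half_chord b d \<noteq> 0"
    using assms by (auto simp: orient_def)
  ultimately have prod: "orient c d a * orient c d b * (orient a b c * orient a b d) > 0"
    by simp
  have "x < 0" if "x * y > 0" "y < 0" for x y :: real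
    using that by (simp add: zero_less_mult_iff)
  from this[OF prod assms] have neg: "orient c d a * orient c d b < 0" .
  have frac: "0 < y / (y - x)" "y / (y - x) < 1" "1 - y / (y - x) = - x / (y - x)" "y \<noteq> x"
    if "x * y < 0" for x y :: real
    using that by (auto simp: mult_less_0_iff zero_less_divide_iff divide_less_eq field_simps)
  \<comment> \<open>The determinant of the two chord directions. The parameters \<open>s\<close> and
    \<open>t\<close> below come from Cramer's rule as ratios of areas.\<close>
  define D where "D = (cos b - cos a) * (sin d - sin c) - (sin b - sin a) * (cos d - cos c)"
  have D1: "area a b d - area a b c = D" and D2: "area c d b - area c d a = - D"
    by (simp_all add: area_def D_def algebra_simps)
  have xy: "area a b c * area a b d < 0" "area c d a * area c d b < 0"
    using assms neg by (simp_all add: area)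
  define s where "s = area a b d / (area a b d - area a b c)"
  define t where "t = area c d b / (area c d b - area c d a)"
  have D0: "D \<noteq> 0" using frac(4)[OF xy(1)] D1 by simp
  have s: "s * D = area a b d" and t: "t * D = - area c d b"
    using D0 by (simp_all add: s_def t_def D1 D2)
  have "D * (t * cos a + (1 - t) * cos b) = (t * D) * (cos a - cos b) + D * cos b"
    by (simp add: algebra_simps)
  also have "\<dots> = (s * D) * (cos c - cos d) + D * cos d"
    unfolding s t by (simp add: area_def D_def algebra_simps)
  also have "\<dots> = D * (s * cos c + (1 - s) * cos d)"
    by (simp add: algebra_simps)
  finally have 1: "t * cos a + (1 - t) * cos b = s * cos c + (1 - s) * cos d"
    using D0 by simp
  have "D * (t * sin a + (1 - t) * sin b) = (t * D) * (sin a - sin b) + D * sin b"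
    by (simp add: algebra_simps)
  also have "\<dots> = (s * D) * (sin c - sin d) + D * sin d"
    unfolding s t by (simp add: area_def D_def algebra_simps)
  also have "\<dots> = D * (s * sin c + (1 - s) * sin d)"
    by (simp add: algebra_simps)
  finally have 2: "t * sin a + (1 - t) * sin b = s * sin c + (1 - s) * sin d"
    using D0 by simp
  show ?thesis
    unfolding chords_cross_def
    using frac(1,2)[OF xy(1)] frac(1,2)[OF xy(2)] 1 2
    by (intro exI[of _ t] exI[of _ s]) (auto simp: s_def t_def)
qed

lemma abs_half_chord: "\<bar>half_chord a b\<bar> = sqrt ((1 - (cos a * cos b + sin a * sin b)) / 2)"
proof -
  have "2 * ((b - a) / 2) = b - a" by simp
  then have "cos (b - a) = 1 - 2 * (half_chord a b)\<^sup>2"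
    unfolding half_chord_def by (metis cos_double_sin)
  then have "(half_chord a b)\<^sup>2 = (1 - (cos a * cos b + sin a * sin b)) / 2"
    by (simp add: cos_diff mult.commute)
  then show ?thesis by (metis real_sqrt_abs)
qed

lemma sgn_eq_if_mult_pos: "(x :: real) * y > 0 \<Longrightarrow> sgn x = sgn y"
  by (auto simp: zero_less_mult_iff)

section \<open>The cyclic order of the vertices of a simple polygon\<close>

text \<open>Both conditions depend only on the angles modulo \<open>2 * pi\<close>, so the
  representatives may be changed later.\<close>

definition simple_cyclic :: "nat \<Rightarrow> (nat \<Rightarrow> real) \<Rightarrow> bool" where
  "simple_cyclic n f \<longleftrightarrow>
    (\<forall>i<n. \<forall>j<n. i \<noteq> j \<longrightarrow> half_chord (f i) (f j) \<noteq> 0) \<and>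
    (\<forall>i<n. \<forall>k<n. {i, Suc i mod n} \<inter> {k, Suc k mod n} = {} \<longrightarrow>
      \<not> chords_cross (f i) (f (Suc i mod n)) (f k) (f (Suc k mod n)))"

text \<open>All vertices other than \<open>i\<close> and \<open>i + 1\<close> lie on one side of the chord \<open>(i, i + 1)\<close>, because the
  polygon joins them without crossing that chord. So both signs below equal that of the triangle
  \<open>(i, i + 1, i + 2)\<close>.\<close>

lemma simple_cyclic_same_side:
  assumes f: "simple_cyclic n f" and n: "n \<ge> 3" and i: "1 \<le> i" "i + 2 < n"
  shows "sgn (orient (f i) (f (i + 1)) (f 0)) = sgn (orient (f (i + 1)) (f (i + 2)) (f 0))"
proof -
  have nz: "orient (f i) (f j) (f k) \<noteq> 0"
    if "i < n" "j < n" "k < n" "i \<noteq> j" "j \<noteq> k" "i \<noteq> k" for i j k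
    using f[unfolded simple_cyclic_def, THEN conjunct1] that by (simp add: orient_def)
  have edge: "sgn (orient (f i) (f (Suc i)) (f k)) = sgn (orient (f i) (f (Suc i)) (f (Suc k mod n)))"
    if "Suc i < n" "k < n" "{i, Suc i} \<inter> {k, Suc k mod n} = {}" for i k
  proof (rule sgn_eq_if_mult_pos)
    have mod: "Suc i mod n = Suc i" using that(1) by simp
    have "{i, Suc i mod n} \<inter> {k, Suc k mod n} = {}"
      using that(3) unfolding mod .
    from f[unfolded simple_cyclic_def, THEN conjunct2, rule_format,
        OF Suc_lessD[OF that(1)] that(2) this]
    have "\<not> chords_cross (f i) (f (Suc i)) (f k) (f (Suc k mod n))"
      unfolding mod .
    then have "\<not> orient (f i) (f (Suc i)) (f k) * orient (f i) (f (Suc i)) (f (Suc k mod n)) < 0"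
      by (rule contrapos_nn) (rule chords_cross_if_separated)
    moreover have "Suc k mod n < n" using that(2) by simp
    then have "orient (f i) (f (Suc i)) (f k) \<noteq> 0" "orient (f i) (f (Suc i)) (f (Suc k mod n)) \<noteq> 0"
      using that by (intro nz; force)+
    ultimately show "orient (f i) (f (Suc i)) (f k) * orient (f i) (f (Suc i)) (f (Suc k mod n)) > 0"
      by (simp add: not_less less_le)
  qed
  have up: "sgn (orient (f i) (f (Suc i)) (f k)) = sgn (orient (f i) (f (Suc i)) (f (i + 2)))"
    if "i + 2 \<le> k" "k < n" for k
    using that
  proof (induction k rule: dec_induct)
    case (step k)
    then show ?case using edge[of i k] by simp
  qed simp
  \<comment> \<open>Since \<open>1 \<le> i\<close>, the closing side from \<open>n - 1\<close> to 0
    also shares no vertex with side \<open>i\<close>.\<close>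
  have "sgn (orient (f i) (f (Suc i)) (f 0)) = sgn (orient (f i) (f (Suc i)) (f (n - 1)))"
    using edge[of i "n - 1"] i n by simp
  also have "\<dots> = sgn (orient (f i) (f (Suc i)) (f (i + 2)))"
    using up[of "n - 1"] i by simp
  also have "\<dots> = sgn (orient (f (Suc i)) (f (i + 2)) (f i))"
    by (simp only: orient_rotate[of "f (Suc i)" "f (i + 2)" "f i"])
  \<comment> \<open>The path from 0 up to \<open>i\<close> avoids the side from \<open>i + 1\<close>
    to \<open>i + 2\<close>.\<close>
  also have "\<dots> = sgn (orient (f (Suc i)) (f (i + 2)) (f 0))"
  proof -
    have "sgn (orient (f (Suc i)) (f (i + 2)) (f k)) = sgn (orient (f (Suc i)) (f (i + 2)) (f 0))"
      if "k \<le> i" for k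
      using that
    proof (induction k)
      case (Suc k)
      then show ?case using edge[of "Suc i" k] i by simp
    qed simp
    from this[of i] show ?thesis by simp
  qed
  finally show ?thesis by simp
qed

text \<open>Measured from vertex 0 all half chords are positive, so the sign of the triangle
  \<open>(i, i + 1, 0)\<close> tells whether the angle rises or falls from \<open>i\<close> to
  \<open>i + 1\<close>. By \<open>simple_cyclic_same_side\<close> this sign never changes.\<close>

lemma simple_cyclic_normalized:
  assumes f: "simple_cyclic n f" and n: "n \<ge> 3"
    and range: "\<And>i. i < n \<Longrightarrow> f 0 \<le> f i \<and> f i < f 0 + 2 * pi"
  shows "(\<forall>i. 1 \<le> i \<and> i + 1 < n \<longrightarrow> f i < f (i + 1)) \<or> (\<forall>i. 1 \<le> i \<and> i + 1 < n \<longrightarrow> f (i + 1) < f i)"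
proof -
  have neq: "half_chord (f i) (f j) \<noteq> 0" if "i < n" "j < n" "i \<noteq> j" for i j
    using f[unfolded simple_cyclic_def, THEN conjunct1] that by simp
  have pos: "half_chord (f 0) (f i) > 0" if "0 < i" "i < n" for i
  proof -
    have "half_chord (f 0) (f i) \<ge> 0"
      unfolding half_chord_def using range[OF that(2)] by (intro sin_ge_zero) auto
    then show ?thesis using neq[of 0 i] that by simp
  qed
  have sgn: "sgn (orient (f i) (f (i + 1)) (f 0)) = sgn (f (i + 1) - f i)"
    if "1 \<le> i" "i + 1 < n" for i
  proof -
    have "orient (f i) (f (i + 1)) (f 0) = half_chord (f i) (f (i + 1)) *
        (half_chord (f 0) (f (i + 1)) * half_chord (f 0) (f i))"
      unfolding orient_def half_chord_commute[of "f (i + 1)" "f 0"] half_chord_commute[of "f i" "f 0"]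
      by simp
    then have "sgn (orient (f i) (f (i + 1)) (f 0)) = sgn (half_chord (f i) (f (i + 1)))"
      using pos[of i] pos[of "i + 1"] that by (simp add: sgn_mult)
    also have "\<dots> = sgn (f (i + 1) - f i)"
    proof (cases "f (i + 1) \<ge> f i")
      case True
      then have "half_chord (f i) (f (i + 1)) \<ge> 0"
        unfolding half_chord_def using range[of i] range[of "i + 1"] that
        by (intro sin_ge_zero) auto
      moreover have "half_chord (f i) (f (i + 1)) \<noteq> 0" using neq[of i "i + 1"] that by simp
      moreover from this have "f (i + 1) \<noteq> f i" by (auto simp: half_chord_def)
      ultimately show ?thesis using True by simp
    next
      case False
      then have "half_chord (f (i + 1)) (f i) > 0"
        unfolding half_chord_def using range[of i] range[of "i + 1"] that
        by (intro sin_gt_zero) auto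
      then show ?thesis using False half_chord_commute[of "f (i + 1)" "f i"] by simp
    qed
    finally show ?thesis .
  qed
  have const: "sgn (f (i + 1) - f i) = sgn (f 2 - f 1)" if "1 \<le> i" "i + 1 < n" for i
    using that
  proof (induction i rule: dec_induct)
    case (step i)
    have "sgn (f (Suc i + 1) - f (Suc i)) = sgn (f (i + 1) - f i)"
      using sgn[of i] sgn[of "Suc i"] simple_cyclic_same_side[OF f n, of i] step by simp
    with step show ?case by simp
  qed (simp add: numeral_2_eq_2)
  have "f 2 \<noteq> f 1" using neq[of 1 2] n by (auto simp: half_chord_def)
  then consider "f 1 < f 2" | "f 2 < f 1" by linarith
  then show ?thesis
  proof cases
    case 1
    then have "f i < f (i + 1)" if "1 \<le> i" "i + 1 < n" for i
      using const[OF that] by (simp add: sgn_if split: if_splits)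
    then show ?thesis by blast
  next
    case 2
    then have "f (i + 1) < f i" if "1 \<le> i" "i + 1 < n" for i
      using const[OF that] by (simp add: sgn_if split: if_splits)
    then show ?thesis by blast
  qed
qed

lemma monotone_cyclic_angles:
  assumes n: "n \<ge> 3" and "R > 0"
    and mono: "\<And>i. i + 1 < n \<Longrightarrow> h i < h (i + 1)" and last: "h (n - 1) < h 0 + 2 * pi"
  shows "\<exists>\<theta>. cyclic_angles n R \<theta> \<and>
    (\<forall>i j. i < j \<and> j < n \<longrightarrow> \<bar>half_chord (h i) (h j)\<bar> = sin (\<Sum>k\<in>{i..<j}. \<theta> k))"
proof -
  \<comment> \<open>The closing side takes what the half increments leave of pi.\<close>
  define \<theta> where "\<theta> k = (if k < n - 1 then (h (k + 1) - h k) / 2 else pi - (h (n - 1) - h 0) / 2)" for k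
  have pos: "\<theta> k > 0" if "k < n" for k
    using mono[of k] last that by (auto simp: \<theta>_def)
  have sum: "(\<Sum>k\<in>{i..<j}. \<theta> k) = (h j - h i) / 2" if "i \<le> j" "j < n" for i j
    using that
  proof (induction j rule: dec_induct)
    case (step j)
    have "\<theta> j = (h (j + 1) - h j) / 2"
      using step.prems less_diff_conv[of j n 1] by (simp add: \<theta>_def)
    with step show ?case by (simp add: field_simps)
  qed simp
  have "(\<Sum>k<n. \<theta> k) = (\<Sum>k\<in>{0..<n - 1}. \<theta> k) + \<theta> (n - 1)"
    using n by (cases n) (auto simp: atLeast0LessThan)
  also have "\<dots> = pi" using sum[of 0 "n - 1"] n by (simp add: \<theta>_def)
  finally have total: "(\<Sum>k<n. \<theta> k) = pi" .
  have "\<bar>half_chord (h i) (h j)\<bar> = sin (\<Sum>k\<in>{i..<j}. \<theta> k)" if "i < j" "j < n" for i j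
  proof -
    have "0 \<le> (\<Sum>k\<in>{i..<j}. \<theta> k)"
      using that pos by (intro sum_nonneg) (auto intro: less_imp_le)
    moreover have "(\<Sum>k\<in>{i..<j}. \<theta> k) \<le> (\<Sum>k<n. \<theta> k)"
      using that pos by (intro sum_mono2) (auto intro: less_imp_le)
    ultimately have "sin (\<Sum>k\<in>{i..<j}. \<theta> k) \<ge> 0"
      using total by (intro sin_ge_zero) auto
    moreover have "(\<Sum>k\<in>{i..<j}. \<theta> k) = (h j - h i) / 2"
      using that by (intro sum) auto
    then have "half_chord (h i) (h j) = sin (\<Sum>k\<in>{i..<j}. \<theta> k)"
      by (simp only: half_chord_def)
    ultimately show ?thesis by simp
  qed
  then show ?thesis using pos total \<open>R > 0\<close> unfolding cyclic_angles_def by blast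
qed

lemma simple_cyclic_angles:
  assumes f: "simple_cyclic n f" and n: "n \<ge> 3" and "R > 0"
  shows "\<exists>\<theta>. cyclic_angles n R \<theta> \<and>
    (\<forall>i j. i < j \<and> j < n \<longrightarrow> \<bar>half_chord (f i) (f j)\<bar> = sin (\<Sum>k\<in>{i..<j}. \<theta> k))"
proof -
  \<comment> \<open>The representatives in the period that starts at \<open>f 0\<close>.\<close>
  define g where "g i = f i - 2 * pi * of_int \<lfloor>(f i - f 0) / (2 * pi)\<rfloor>" for i
  have trig: "cos (g i) = cos (f i)" "sin (g i) = sin (f i)" for i
    unfolding g_def cos_diff sin_diff by simp_all
  have chord: "\<bar>half_chord (g i) (g j)\<bar> = \<bar>half_chord (f i) (f j)\<bar>" for i j
    by (simp add: abs_half_chord trig)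
  have range: "g 0 \<le> g i \<and> g i < g 0 + 2 * pi" for i
  proof -
    let ?q = "(f i - f 0) / (2 * pi)"
    have "of_int \<lfloor>?q\<rfloor> \<le> ?q" "?q < of_int \<lfloor>?q\<rfloor> + 1" by linarith+
    then have "2 * pi * of_int \<lfloor>?q\<rfloor> \<le> 2 * pi * ?q" "2 * pi * ?q < 2 * pi * (of_int \<lfloor>?q\<rfloor> + 1)"
      by (intro mult_left_mono mult_strict_left_mono; simp)+
    then have "2 * pi * of_int \<lfloor>?q\<rfloor> \<le> f i - f 0" "f i - f 0 < 2 * pi * (of_int \<lfloor>?q\<rfloor> + 1)"
      by simp_all
    moreover have "g 0 = f 0" by (simp add: g_def)
    ultimately show ?thesis by (simp add: g_def algebra_simps)
  qed
  have g: "simple_cyclic n g"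
  proof -
    have "chords_cross (g i) (g j) (g k) (g l) = chords_cross (f i) (f j) (f k) (f l)" for i j k l
      by (simp add: chords_cross_def trig)
    moreover have "half_chord (g i) (g j) = 0 \<longleftrightarrow> half_chord (f i) (f j) = 0" for i j
      using chord[of i j] by (metis abs_eq_0_iff)
    ultimately show ?thesis using f by (simp only: simple_cyclic_def)
  qed
  have gt: "g 0 < g i" if "0 < i" "i < n" for i
  proof -
    have "half_chord (g 0) (g i) \<noteq> 0" using g[unfolded simple_cyclic_def, THEN conjunct1] that by simp
    then have "g i \<noteq> g 0" by (auto simp: half_chord_def)
    with range[of i] show ?thesis by simp
  qed
  from simple_cyclic_normalized[OF g n range] show ?thesis
  proof
    assume inc: "\<forall>i. 1 \<le> i \<and> i + 1 < n \<longrightarrow> g i < g (i + 1)"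
    have "g i < g (i + 1)" if "i + 1 < n" for i
      using inc that gt[of 1] n by (cases i) auto
    from monotone_cyclic_angles[OF n \<open>R > 0\<close>, of g, OF this] range show ?thesis
      by (simp add: chord)
  next
    assume dec: "\<forall>i. 1 \<le> i \<and> i + 1 < n \<longrightarrow> g (i + 1) < g i"
    \<comment> \<open>The reflection \<open>x -> 2 * g 0 - x\<close> reverses clockwise order. The
      added \<open>2 * pi\<close> moves the values back above \<open>g 0\<close>; vertex 0 is fixed
      by the reflection and gets no shift.\<close>
    define h where "h i = (if i = 0 then g 0 else 2 * g 0 + 2 * pi - g i)" for i
    have "h i < h (i + 1)" if "i + 1 < n" for i
      using dec that range[of 1] by (cases i) (auto simp: h_def)
    moreover have "h (n - 1) < h 0 + 2 * pi"
      using gt[of "n - 1"] n by (simp add: h_def)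
    moreover have "\<bar>half_chord (h i) (h j)\<bar> = \<bar>half_chord (g i) (g j)\<bar>" if "i < j" for i j
    proof (cases "i = 0")
      case True
      have "sin ((g 0 + 2 * pi - g j) / 2) = sin (pi - (g j - g 0) / 2)"
        by (simp add: field_simps)
      moreover have "h j - h i = g 0 + 2 * pi - g j"
        using True that by (simp add: h_def)
      ultimately show ?thesis using True by (simp add: half_chord_def)
    next
      case False
      then have "half_chord (h i) (h j) = half_chord (g j) (g i)"
        using that by (simp add: half_chord_def h_def)
      then show ?thesis using half_chord_commute[of "g i" "g j"] by simp
    qed
    ultimately show ?thesis
      using monotone_cyclic_angles[OF n \<open>R > 0\<close>, of h] by (simp add: chord)
  qed
qed

text \<open>The sum runs over the arc between \<open>i\<close> and \<open>j\<close> that avoids the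
  closing side. The complementary arc would give the same sine, as the total is pi.\<close>

definition realized_by ::
    "(real \<Rightarrow> real) \<Rightarrow> ('a \<Rightarrow> 'a \<Rightarrow> real) \<Rightarrow> 'a list \<Rightarrow> real \<Rightarrow> (nat \<Rightarrow> real) \<Rightarrow> bool" where
  "realized_by s d P R \<theta> \<longleftrightarrow>
     cyclic_angles (length P) R \<theta> \<and>
     side_values s d P = map (\<lambda>k. R * sin (\<theta> k)) [0..<length P] \<and>
     (\<forall>i<length P. \<forall>j<length P. i \<noteq> j \<longrightarrow>
       s (d (P ! i) (P ! j)) = R * sin (\<Sum>k\<in>{min i j..<max i j}. \<theta> k))"

text \<open>The map \<open>N\<close> pushes a point of the linear chord radially to the geodesic segment, so that
  crossing linear chords give a common point of two sides.\<close>

lemma polygon_on_circle_realized: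
  fixes C U V :: "'v::real_vector" and f :: "nat \<Rightarrow> real"
  assumes poly: "polygon M d P"
    and P: "\<And>i. i < length P \<Longrightarrow> P ! i = C + (R * cos (f i)) *\<^sub>R U + (R * sin (f i)) *\<^sub>R V"
    and sd: "\<And>i j. i < length P \<Longrightarrow> j < length P \<Longrightarrow>
      s (d (P ! i) (P ! j)) = R * \<bar>half_chord (f i) (f j)\<bar>"
    and R: "R \<ge> 0"
    and N: "\<And>A B t. A \<in> set P \<Longrightarrow> B \<in> set P \<Longrightarrow> 0 < t \<Longrightarrow> t < 1 \<Longrightarrow>
      N (t *\<^sub>R A + (1 - t) *\<^sub>R B) \<in> segment M d A B"
  shows "\<exists>\<theta>. realized_by s d P R \<theta>"
proof -
  define n where "n = length P"
  have n: "n \<ge> 3" and dist: "distinct P"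
    using poly by (auto simp: polygon_def n_def)
  have neq: "P ! i \<noteq> P ! j" if "i < n" "j < n" "i \<noteq> j" for i j
    using that dist by (simp add: nth_eq_iff_index_eq n_def)
  have "R \<noteq> 0"
  proof
    assume "R = 0"
    moreover have "0 < length P" "1 < length P" using n by (auto simp: n_def)
    ultimately have "P ! 0 = P ! 1" using P[of 0] P[of 1] by simp
    then show False using neq[of 0 1] n by simp
  qed
  with R have "R > 0" by simp
  have hc: "half_chord (f i) (f j) \<noteq> 0" if "i < n" "j < n" "i \<noteq> j" for i j
  proof
    assume "half_chord (f i) (f j) = 0"
    then have "sin ((f j - f i) / 2) = 0" by (simp add: half_chord_def)
    then have "cos (f i) = cos (f j)" "sin (f i) = sin (f j)"
      using cos_diff_cos[of "f i" "f j"] sin_diff_sin[of "f j" "f i"] by auto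
    then have "P ! i = P ! j" using P that by (simp add: n_def)
    then show False using neq that by blast
  qed
  have comb: "t *\<^sub>R (C + (R * x) *\<^sub>R U + (R * y) *\<^sub>R V) + (1 - t) *\<^sub>R (C + (R * x') *\<^sub>R U + (R * y') *\<^sub>R V)
      = C + (R * (t * x + (1 - t) * x')) *\<^sub>R U + (R * (t * y + (1 - t) * y')) *\<^sub>R V" for t x y x' y'
    by (simp add: algebra_simps)
  have nocross: "\<not> chords_cross (f i) (f (Suc i mod n)) (f k) (f (Suc k mod n))"
    if ik: "i < n" "k < n" "{i, Suc i mod n} \<inter> {k, Suc k mod n} = {}" for i k
  proof
    let ?i = "Suc i mod n" and ?k = "Suc k mod n"
    have less: "?i < n" "?k < n" using ik by simp_all
    assume "chords_cross (f i) (f ?i) (f k) (f ?k)"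
    then obtain t s where ts: "0 < t" "t < 1" "0 < s" "s < 1"
      and eq: "t * cos (f i) + (1 - t) * cos (f ?i) = s * cos (f k) + (1 - s) * cos (f ?k)"
        "t * sin (f i) + (1 - t) * sin (f ?i) = s * sin (f k) + (1 - s) * sin (f ?k)"
      unfolding chords_cross_def by blast
    have Y: "t *\<^sub>R P ! i + (1 - t) *\<^sub>R P ! ?i = s *\<^sub>R P ! k + (1 - s) *\<^sub>R P ! ?k"
      using P ik less by (simp only: n_def [symmetric] comb eq)
    have mem: "P ! i \<in> set P" "P ! ?i \<in> set P" "P ! k \<in> set P" "P ! ?k \<in> set P"
      using ik less by (simp_all add: n_def)
    have "N (t *\<^sub>R P ! i + (1 - t) *\<^sub>R P ! ?i) \<in>
        segment M d (P ! i) (P ! ?i) \<inter> segment M d (P ! k) (P ! ?k)"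
      using N[OF mem(1,2) ts(1,2)] N[OF mem(3,4) ts(3,4)] Y by simp
    moreover have "segment M d (P ! i) (P ! ?i) \<inter> segment M d (P ! k) (P ! ?k)
        = {P ! i, P ! ?i} \<inter> {P ! k, P ! ?k}"
    proof -
      have "i \<noteq> k" using ik(3) by auto
      then show ?thesis
        using poly ik unfolding polygon_def next_vertex_def n_def by blast
    qed
    moreover have "{P ! i, P ! ?i} \<inter> {P ! k, P ! ?k} = {}"
      using ik less neq[of i k] neq[of i ?k] neq[of ?i k] neq[of ?i ?k] by auto
    ultimately show False by simp
  qed
  have "simple_cyclic n f"
    unfolding simple_cyclic_def using hc nocross by blast
  from simple_cyclic_angles[OF this n \<open>R > 0\<close>] obtain \<theta> where \<theta>: "cyclic_angles n R \<theta>"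
    and chord: "\<And>i j. i < j \<Longrightarrow> j < n \<Longrightarrow> \<bar>half_chord (f i) (f j)\<bar> = sin (\<Sum>k\<in>{i..<j}. \<theta> k)"
    by blast
  have diag: "s (d (P ! i) (P ! j)) = R * sin (\<Sum>k\<in>{min i j..<max i j}. \<theta> k)"
    if "i < n" "j < n" "i \<noteq> j" for i j
  proof -
    have "\<bar>half_chord (f i) (f j)\<bar> = \<bar>half_chord (f (min i j)) (f (max i j))\<bar>"
      using half_chord_commute[of "f i" "f j"] by (auto simp: min_def max_def)
    then show ?thesis using sd chord[of "min i j" "max i j"] that by (simp add: n_def)
  qed
  have "s (d (P ! k) (next_vertex P k)) = R * sin (\<theta> k)" if "k < n" for k
  proof (cases "Suc k < n")
    case True
    then show ?thesis using diag[of k "Suc k"] by (simp add: next_vertex_def n_def)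
  next
    case False
    then have k: "k = n - 1" using that by simp
    have "(\<Sum>k<n. \<theta> k) = (\<Sum>k\<in>{0..<n - 1}. \<theta> k) + \<theta> (n - 1)"
      using n by (cases n) (auto simp: atLeast0LessThan)
    \<comment> \<open>The closing side is the chord from 0 to \<open>n - 1\<close>, whose arc
      consists of all the other angles.\<close>
    then have "(\<Sum>k\<in>{0..<n - 1}. \<theta> k) = pi - \<theta> k" using \<theta> k by (simp add: cyclic_angles_def)
    moreover have "Suc k = length P" using k n by (simp add: n_def)
    then have "next_vertex P k = P ! 0" by (simp add: next_vertex_def)
    ultimately show ?thesis using diag[of k 0] k n by simp
  qed
  then have "side_values s d P = map (\<lambda>k. R * sin (\<theta> k)) [0..<n]"
    by (simp add: side_values_def n_def)
  with \<theta> diag show ?thesis unfolding realized_by_def n_def by blast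
qed

lemma polar_coordinates:
  fixes x y r :: real
  assumes "x\<^sup>2 + y\<^sup>2 = r\<^sup>2"
  obtains \<phi> where "x = r * cos \<phi>" "y = r * sin \<phi>"
proof (cases "r = 0")
  case True
  then show ?thesis using assms that[of 0] by (simp add: sum_power2_eq_zero_iff)
next
  case False
  then have "(x / r)\<^sup>2 + (y / r)\<^sup>2 = 1"
    using assms by (simp add: power_divide add_divide_distrib [symmetric])
  then obtain \<phi> where "x / r = cos \<phi>" "y / r = sin \<phi>"
    using sincos_total_2pi[of "x / r" "y / r"] by metis
  then show ?thesis using False that[of \<phi>] by (simp add: field_simps)
qed

lemma half_chord_square: "(half_chord a b)\<^sup>2 = (1 - (cos a * cos b + sin a * sin b)) / 2"
proof -
  have "(cos a * cos b + sin a * sin b) \<le> 1"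
    using cos_le_one[of "a - b"] by (simp add: cos_diff)
  then show ?thesis
    using abs_half_chord[of a b] by (metis real_sqrt_pow2 power2_abs diff_ge_0_iff_ge
        divide_nonneg_pos zero_less_numeral)
qed

lemma euclidean_cyclic_polygon_realized:
  fixes P :: "(real ^ 2) list"
  assumes "cyclic_polygon UNIV dist n P r"
  shows "\<exists>\<theta>. realized_by s_euclidean dist P (s_euclidean (2 * r)) \<theta>"
proof -
  obtain c where poly: "polygon UNIV dist P" and r: "r > 0" and c: "\<And>X. X \<in> set P \<Longrightarrow> dist c X = r"
    using assms by (auto simp: cyclic_polygon_def)
  have "\<exists>\<phi>. X = c + (r * cos \<phi>) *\<^sub>R axis 1 1 + (r * sin \<phi>) *\<^sub>R axis 2 1" if "X \<in> set P" for X
  proof -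
    have "(X $ 1 - c $ 1)\<^sup>2 + (X $ 2 - c $ 2)\<^sup>2 = r\<^sup>2"
      using c[OF that] r
      by (simp add: dist_vec_def L2_set_def UNIV_2 dist_real_def power2_commute real_sqrt_eq_iff)
        (metis real_sqrt_pow2 sum_power2_ge_zero)
    then obtain \<phi> where "X $ 1 - c $ 1 = r * cos \<phi>" "X $ 2 - c $ 2 = r * sin \<phi>"
      by (rule polar_coordinates)
    then show ?thesis
      by (intro exI[of _ \<phi>]) (auto simp: vec_eq_iff forall_2 axis_def)
  qed
  then obtain \<phi> where \<phi>: "\<And>X. X \<in> set P \<Longrightarrow>
      X = c + (r * cos (\<phi> X)) *\<^sub>R axis 1 1 + (r * sin (\<phi> X)) *\<^sub>R axis 2 1"
    by metis
  define f where "f i = \<phi> (P ! i)" for i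
  have f: "P ! i = c + (r * cos (f i)) *\<^sub>R axis 1 1 + (r * sin (f i)) *\<^sub>R axis 2 1"
    if "i < length P" for i
    unfolding f_def using \<phi>[of "P ! i"] that by simp
  have "s_euclidean (2 * r) = r" by (simp add: s_euclidean_def)
  show ?thesis
    unfolding \<open>s_euclidean (2 * r) = r\<close>
  proof (rule polygon_on_circle_realized[OF poly f, where N = "\<lambda>Y. Y"])
    fix i j assume ij: "i < length P" "j < length P"
    have "(dist (P ! i) (P ! j))\<^sup>2 = (r * cos (f i) - r * cos (f j))\<^sup>2 + (r * sin (f i) - r * sin (f j))\<^sup>2"
      unfolding f[OF ij(1)] f[OF ij(2)]
      by (simp add: dist_vec_def L2_set_def UNIV_2 dist_real_def axis_def)
    also have "\<dots> = r\<^sup>2 * ((sin (f i))\<^sup>2 + (cos (f i))\<^sup>2 + ((sin (f j))\<^sup>2 + (cos (f j))\<^sup>2)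
        - 2 * (cos (f i) * cos (f j) + sin (f i) * sin (f j)))"
      by algebra
    also have "\<dots> = (2 * r * \<bar>half_chord (f i) (f j)\<bar>)\<^sup>2"
      by (simp add: power_mult_distrib half_chord_square)
    finally have "dist (P ! i) (P ! j) = 2 * r * \<bar>half_chord (f i) (f j)\<bar>"
      using r by (simp add: power2_eq_iff_nonneg)
    then show "s_euclidean (dist (P ! i) (P ! j)) = r * \<bar>half_chord (f i) (f j)\<bar>"
      by (simp add: s_euclidean_def)
  next
    fix A B :: "real ^ 2" and t :: real assume t: "0 < t" "t < 1"
    have "A - (t *\<^sub>R A + (1 - t) *\<^sub>R B) = (1 - t) *\<^sub>R (A - B)"
      "(t *\<^sub>R A + (1 - t) *\<^sub>R B) - B = t *\<^sub>R (A - B)"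
      by (simp_all add: algebra_simps)
    then have "dist A (t *\<^sub>R A + (1 - t) *\<^sub>R B) = (1 - t) * dist A B"
      "dist (t *\<^sub>R A + (1 - t) *\<^sub>R B) B = t * dist A B"
      using t by (simp_all only: dist_norm norm_scaleR abs_of_pos diff_gt_0_iff_gt)
    then show "t *\<^sub>R A + (1 - t) *\<^sub>R B \<in> segment UNIV dist A B"
      by (simp add: segment_def algebra_simps)
  qed (use r in auto)
qed

section \<open>Additivity of the distance at a projected chord point\<close>

text \<open>For unit vectors \<open>A\<close>, \<open>B\<close> with inner product \<open>c\<close>,
  \<open>w\<close> is the norm of \<open>t *\<^sub>R A + (1 - t) *\<^sub>R B\<close>, and the two
  arguments are the cosines of its angles to \<open>A\<close> and \<open>B\<close>. The addition
  theorem gives the cosine of their sum.\<close>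

lemma arccos_add_on_chord:
  fixes t c w :: real
  assumes t: "0 < t" "t < 1" and c: "- 1 \<le> c" "c \<le> 1"
    and w: "0 < w" "w\<^sup>2 = t\<^sup>2 + (1 - t)\<^sup>2 + 2 * t * (1 - t) * c"
  shows "arccos ((t + (1 - t) * c) / w) + arccos (((1 - t) + t * c) / w) = arccos c"
proof -
  define a where "a = (t + (1 - t) * c) / w"
  define b where "b = ((1 - t) + t * c) / w"
  \<comment> \<open>The sine of the whole angle; the partial angles have sines
    \<open>(1 - t) * k / w\<close> and \<open>t * k / w\<close>.\<close>
  define k where "k = sqrt (1 - c\<^sup>2)"
  have k: "k \<ge> 0" "k\<^sup>2 = 1 - c\<^sup>2" using c by (auto simp: k_def abs_square_le_1 abs_le_iff)
  have sq: "1 - a\<^sup>2 = ((1 - t) * k / w)\<^sup>2" "1 - b\<^sup>2 = (t * k / w)\<^sup>2"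
  proof -
    have "w\<^sup>2 - (t + (1 - t) * c)\<^sup>2 = ((1 - t) * k)\<^sup>2" "w\<^sup>2 - ((1 - t) + t * c)\<^sup>2 = (t * k)\<^sup>2"
      unfolding power_mult_distrib k(2) w(2) by algebra+
    moreover have "1 - a\<^sup>2 = (w\<^sup>2 - (t + (1 - t) * c)\<^sup>2) / w\<^sup>2"
      "1 - b\<^sup>2 = (w\<^sup>2 - ((1 - t) + t * c)\<^sup>2) / w\<^sup>2"
      using w(1) by (simp_all add: a_def b_def power_divide diff_divide_distrib)
    ultimately show "1 - a\<^sup>2 = ((1 - t) * k / w)\<^sup>2" "1 - b\<^sup>2 = (t * k / w)\<^sup>2"
      by (simp_all only: power_divide)
  qed
  have ab: "-1 \<le> a" "a \<le> 1" "-1 \<le> b" "b \<le> 1"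
  proof -
    have "a\<^sup>2 \<le> 1" "b\<^sup>2 \<le> 1" using sq zero_le_power2[of "(1 - t) * k / w"] zero_le_power2[of "t * k / w"]
      by linarith+
    then show "-1 \<le> a" "a \<le> 1" "-1 \<le> b" "b \<le> 1" by (auto simp: abs_square_le_1 abs_le_iff)
  qed
  have "cos (arccos a + arccos b) = a * b - sqrt (1 - a\<^sup>2) * sqrt (1 - b\<^sup>2)"
    using ab by (simp add: cos_add sin_arccos)
  also have "\<dots> = a * b - (1 - t) * k / w * (t * k / w)"
    unfolding sq using t k w(1) by simp
  also have "\<dots> = ((t + (1 - t) * c) * ((1 - t) + t * c) - t * (1 - t) * k\<^sup>2) / w\<^sup>2"
    by (simp add: a_def b_def power2_eq_square diff_divide_distrib)
  also have "\<dots> = c * w\<^sup>2 / w\<^sup>2"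
    unfolding k(2) w(2) by (rule arg_cong2[where f = "(/)"]) (algebra, simp)
  finally have cos: "cos (arccos a + arccos b) = c" using w(1) by simp
  \<comment> \<open>This bounds the sum of the two angles by pi, so that \<open>arccos\<close>
    inverts its cosine.\<close>
  have "- a \<le> b"
  proof -
    have "a + b = (1 + c) / w" by (simp add: a_def b_def add_divide_distrib [symmetric] algebra_simps)
    also have "\<dots> \<ge> 0" using c w(1) by simp
    finally show ?thesis by simp
  qed
  then have "arccos b \<le> arccos (- a)" using ab by (intro arccos_le_arccos) auto
  then have "arccos a + arccos b \<le> pi" using ab by (simp add: arccos_minus)
  moreover have "0 \<le> arccos a + arccos b" using ab by (simp add: arccos_lbound add_nonneg_nonneg)
  ultimately have "arccos (cos (arccos a + arccos b)) = arccos a + arccos b"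
    by (intro arccos_cos) auto
  then have "arccos a + arccos b = arccos c" by (simp add: cos)
  then show ?thesis by (simp only: a_def b_def)
qed

text \<open>The same computation for two points with Minkowski product \<open>- c\<close>. The sum
  of the two distances is nonnegative, so \<open>arcosh\<close> inverts its
  \<open>cosh\<close>.\<close>

lemma arcosh_add_on_chord:
  fixes t c w :: real
  assumes t: "0 < t" "t < 1" and c: "1 \<le> c"
    and w: "0 < w" "w\<^sup>2 = t\<^sup>2 + (1 - t)\<^sup>2 + 2 * t * (1 - t) * c"
  shows "arcosh ((t + (1 - t) * c) / w) + arcosh (((1 - t) + t * c) / w) = arcosh c"
proof -
  define a where "a = (t + (1 - t) * c) / w"
  define b where "b = ((1 - t) + t * c) / w"
  define k where "k = sqrt (c\<^sup>2 - 1)"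
  have k: "k \<ge> 0" "k\<^sup>2 = c\<^sup>2 - 1" using c by (auto simp: k_def)
  have sq: "a\<^sup>2 - 1 = ((1 - t) * k / w)\<^sup>2" "b\<^sup>2 - 1 = (t * k / w)\<^sup>2"
  proof -
    have "(t + (1 - t) * c)\<^sup>2 - w\<^sup>2 = ((1 - t) * k)\<^sup>2" "((1 - t) + t * c)\<^sup>2 - w\<^sup>2 = (t * k)\<^sup>2"
      unfolding power_mult_distrib k(2) w(2) by algebra+
    moreover have "a\<^sup>2 - 1 = ((t + (1 - t) * c)\<^sup>2 - w\<^sup>2) / w\<^sup>2"
      "b\<^sup>2 - 1 = (((1 - t) + t * c)\<^sup>2 - w\<^sup>2) / w\<^sup>2"
      using w(1) by (simp_all add: a_def b_def power_divide diff_divide_distrib)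
    ultimately show "a\<^sup>2 - 1 = ((1 - t) * k / w)\<^sup>2" "b\<^sup>2 - 1 = (t * k / w)\<^sup>2"
      by (simp_all only: power_divide)
  qed
  have pos: "0 \<le> a" "0 \<le> b"
    using t c w(1) by (auto simp: a_def b_def intro!: divide_nonneg_pos add_nonneg_nonneg mult_nonneg_nonneg)
  have ab: "1 \<le> a" "1 \<le> b"
  proof -
    have "1 \<le> a\<^sup>2" "1 \<le> b\<^sup>2"
      using sq zero_le_power2[of "(1 - t) * k / w"] zero_le_power2[of "t * k / w"] by linarith+
    then show "1 \<le> a" "1 \<le> b"
      using pos power2_le_imp_le[of 1 a] power2_le_imp_le[of 1 b] by simp_all
  qed
  have "cosh (arcosh a + arcosh b) = a * b + sqrt (a\<^sup>2 - 1) * sqrt (b\<^sup>2 - 1)"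
    using ab by (simp add: cosh_add sinh_arcosh_real)
  also have "\<dots> = a * b + (1 - t) * k / w * (t * k / w)"
    unfolding sq using t k w(1) by simp
  also have "\<dots> = ((t + (1 - t) * c) * ((1 - t) + t * c) + t * (1 - t) * k\<^sup>2) / w\<^sup>2"
    by (simp add: a_def b_def power2_eq_square add_divide_distrib [symmetric] mult_ac)
  also have "\<dots> = c * w\<^sup>2 / w\<^sup>2"
    unfolding k(2) w(2) by (rule arg_cong2[where f = "(/)"]) (algebra, simp)
  finally have "cosh (arcosh a + arcosh b) = c" using w(1) by simp
  moreover have "arcosh (cosh (arcosh a + arcosh b)) = arcosh a + arcosh b"
    using ab by (intro arcosh_cosh_real add_nonneg_nonneg arcosh_nonneg_real)
  ultimately have "arcosh a + arcosh b = arcosh c" by simp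
  then show ?thesis by (simp only: a_def b_def)
qed

section \<open>The sphere and the hyperbolic plane\<close>

text \<open>The vector \<open>Y\<close> vanishes only for antipodal \<open>A\<close> and
  \<open>B\<close>. Then every point of the sphere lies in the segment, and \<open>axis 1 1\<close>
  is an arbitrary choice.\<close>

lemma spherical_radial_projection_in_segment:
  fixes A B :: "real ^ 3"
  assumes A: "norm A = 1" and B: "norm B = 1" and t: "0 < t" "t < 1"
    and Y: "Y = t *\<^sub>R A + (1 - t) *\<^sub>R B"
  shows "(if Y = 0 then axis 1 1 else Y /\<^sub>R norm Y) \<in> segment unit_sphere spherical_dist A B"
proof (cases "Y = 0")
  case True
  then have "t *\<^sub>R A = - ((1 - t) *\<^sub>R B)" using Y by (simp add: eq_neg_iff_add_eq_0)
  moreover from this have "norm (t *\<^sub>R A) = norm ((1 - t) *\<^sub>R B)" by simp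
  then have "t = 1 - t" using A B t by simp
  ultimately have "t *\<^sub>R A = t *\<^sub>R (- B)" by simp
  then have AB: "A = - B" using t by (simp only: real_vector.scale_cancel_left) simp
  have "\<bar>B \<bullet> axis 1 1\<bar> \<le> 1" using Cauchy_Schwarz_ineq2[of B "axis 1 1"] B by simp
  then have "arccos (A \<bullet> axis 1 1) + arccos (axis 1 1 \<bullet> B) = arccos (A \<bullet> B)"
    using B by (simp add: AB arccos_minus abs_le_iff inner_commute dot_square_norm)
  then show ?thesis
    using True by (simp add: segment_def unit_sphere_def spherical_dist_def)
next
  case False
  let ?c = "A \<bullet> B"
  have c: "- 1 \<le> ?c" "?c \<le> 1" using Cauchy_Schwarz_ineq2[of A B] A B by (auto simp: abs_le_iff)
  have AA: "A \<bullet> A = 1" "B \<bullet> B = 1" using A B by (simp_all add: dot_square_norm)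
  have w: "0 < norm Y" "(norm Y)\<^sup>2 = t\<^sup>2 + (1 - t)\<^sup>2 + 2 * t * (1 - t) * ?c"
    using False unfolding power2_norm_eq_inner
    by (simp_all add: Y inner_add_left inner_add_right AA inner_commute[of B A] power2_eq_square
        algebra_simps)
  have "A \<bullet> (Y /\<^sub>R norm Y) = (t + (1 - t) * ?c) / norm Y"
    "(Y /\<^sub>R norm Y) \<bullet> B = ((1 - t) + t * ?c) / norm Y"
    by (simp_all add: Y inner_add_left inner_add_right AA divide_inverse mult.commute add.commute)
  then have "spherical_dist A (Y /\<^sub>R norm Y) + spherical_dist (Y /\<^sub>R norm Y) B = spherical_dist A B"
    using arccos_add_on_chord[OF t c w] by (simp only: spherical_dist_def)
  then show ?thesis
    using False by (simp add: segment_def unit_sphere_def)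
qed

lemma spherical_cyclic_polygon_realized:
  assumes "cyclic_polygon unit_sphere spherical_dist n P r"
  shows "\<exists>\<theta>. realized_by s_spherical spherical_dist P (s_spherical (2 * r)) \<theta>"
proof -
  obtain c where poly: "polygon unit_sphere spherical_dist P" and c: "norm c = 1"
    and cr: "\<And>X. X \<in> set P \<Longrightarrow> arccos (c \<bullet> X) = r"
    using assms by (auto simp: cyclic_polygon_def unit_sphere_def spherical_dist_def)
  have unit: "norm X = 1" if "X \<in> set P" for X
    using poly that by (auto simp: polygon_def unit_sphere_def)
  have bound: "- 1 \<le> X \<bullet> Y" "X \<bullet> Y \<le> 1" if "norm X = 1" "norm Y = 1" for X Y :: "real ^ 3"
    using Cauchy_Schwarz_ineq2[of X Y] that by (auto simp: abs_le_iff)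
  have inner: "c \<bullet> X = cos r" if "X \<in> set P" for X
    using cr[OF that] bound[OF c unit[OF that]] cos_arccos[of "c \<bullet> X"] by simp
  \<comment> \<open>An isometry that moves the pole to \<open>c\<close>, so that the circle becomes
    a circle of latitude in the coordinates \<open>x\<close>.\<close>
  obtain F :: "real ^ 3 \<Rightarrow> real ^ 3" where F: "orthogonal_transformation F" "F (axis 3 1) = c"
    using orthogonal_transformation_exists[of "axis 3 1" c] c by auto
  have lin: "linear F" and iso: "\<And>x y. F x \<bullet> F y = x \<bullet> y"
    using F(1) by (auto simp: orthogonal_transformation_def)
  have "\<exists>\<phi>. X = cos r *\<^sub>R c + (sin r * cos \<phi>) *\<^sub>R F (axis 1 1) + (sin r * sin \<phi>) *\<^sub>R F (axis 2 1)"
    if X: "X \<in> set P" for X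
  proof -
    obtain x where x: "X = F x" using orthogonal_transformation_surj[OF F(1)] by blast
    have x3: "x $ 3 = cos r"
      using inner[OF X] iso[of "axis 3 1" x] F(2) x by (simp add: inner_axis')
    have "x \<bullet> x = 1" using unit[OF X] iso[of x x] x by (simp add: dot_square_norm)
    then have "(x $ 1)\<^sup>2 + (x $ 2)\<^sup>2 + (cos r)\<^sup>2 = 1"
      by (simp add: inner_vec_def sum_3 x3 power2_eq_square)
    then have "(x $ 1)\<^sup>2 + (x $ 2)\<^sup>2 = (sin r)\<^sup>2"
      by (simp add: sin_squared_eq)
    then obtain \<phi> where "x $ 1 = sin r * cos \<phi>" "x $ 2 = sin r * sin \<phi>"
      by (rule polar_coordinates)
    then have "x = cos r *\<^sub>R axis 3 1 + (sin r * cos \<phi>) *\<^sub>R axis 1 1 + (sin r * sin \<phi>) *\<^sub>R axis 2 1"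
      by (simp add: vec_eq_iff forall_3 axis_def x3)
    then have "F x = F (cos r *\<^sub>R axis 3 1 + (sin r * cos \<phi>) *\<^sub>R axis 1 1
        + (sin r * sin \<phi>) *\<^sub>R axis 2 1)"
      by (rule arg_cong)
    also have "\<dots> = cos r *\<^sub>R c + (sin r * cos \<phi>) *\<^sub>R F (axis 1 1) + (sin r * sin \<phi>) *\<^sub>R F (axis 2 1)"
      by (simp only: linear_add[OF lin] linear_scale[OF lin] F(2))
    finally have "F x = cos r *\<^sub>R c + (sin r * cos \<phi>) *\<^sub>R F (axis 1 1) + (sin r * sin \<phi>) *\<^sub>R F (axis 2 1)" .
    then show ?thesis using x by blast
  qed
  then obtain \<phi> where \<phi>: "\<And>X. X \<in> set P \<Longrightarrow>
      X = cos r *\<^sub>R c + (sin r * cos (\<phi> X)) *\<^sub>R F (axis 1 1) + (sin r * sin (\<phi> X)) *\<^sub>R F (axis 2 1)"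
    by metis
  define f where "f i = \<phi> (P ! i)" for i
  have f: "P ! i = cos r *\<^sub>R c + (sin r * cos (f i)) *\<^sub>R F (axis 1 1) + (sin r * sin (f i)) *\<^sub>R F (axis 2 1)"
    if "i < length P" for i
    unfolding f_def using \<phi>[of "P ! i"] that by simp
  have "P \<noteq> []" using poly by (auto simp: polygon_def)
  then have "hd P \<in> set P" by simp
  \<comment> \<open>The range of \<open>arccos\<close>. A radius may exceed \<open>pi / 2\<close>;
    the same circle then has radius \<open>pi - r\<close> about the antipode of \<open>c\<close>,
    with the same sine.\<close>
  then have "0 \<le> r" "r \<le> pi"
    using cr[of "hd P"] bound[OF c unit, of "hd P"] arccos_bounded[of "c \<bullet> hd P"] by auto
  then have r: "sin r \<ge> 0" by (rule sin_ge_zero)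
  have "s_spherical (2 * r) = sin r" by (simp add: s_spherical_def)
  show ?thesis
    unfolding \<open>s_spherical (2 * r) = sin r\<close>
  proof (rule polygon_on_circle_realized[OF poly f _ r,
      where N = "\<lambda>Y. if Y = 0 then axis 1 1 else Y /\<^sub>R norm Y"])
    fix i j assume ij: "i < length P" "j < length P"
    let ?p = "P ! i \<bullet> P ! j"
    have p: "- 1 \<le> ?p" "?p \<le> 1" using ij by (intro bound unit; simp)+
    have "?p = (cos r)\<^sup>2 + (sin r)\<^sup>2 * (cos (f i) * cos (f j) + sin (f i) * sin (f j))"
      unfolding f[OF ij(1)] f[OF ij(2)] F(2) [symmetric]
      by (simp add: inner_add_left inner_add_right iso inner_axis_axis power2_eq_square algebra_simps)
    also have "\<dots> = 1 - 2 * (sin r * \<bar>half_chord (f i) (f j)\<bar>)\<^sup>2"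
      by (simp add: power_mult_distrib half_chord_square cos_squared_eq field_simps)
    finally have p_eq: "?p = 1 - 2 * (sin r * \<bar>half_chord (f i) (f j)\<bar>)\<^sup>2" .
    have "2 * (arccos ?p / 2) = arccos ?p" by simp
    then have "?p = 1 - 2 * (sin (arccos ?p / 2))\<^sup>2"
      using cos_double_sin[of "arccos ?p / 2"] cos_arccos[OF p] by metis
    with p_eq have "(sin (arccos ?p / 2))\<^sup>2 = (sin r * \<bar>half_chord (f i) (f j)\<bar>)\<^sup>2" by simp
    moreover have "sin (arccos ?p / 2) \<ge> 0"
      using arccos_bounded[OF p] by (intro sin_ge_zero) auto
    moreover have "sin r * \<bar>half_chord (f i) (f j)\<bar> \<ge> 0" using r by simp
    ultimately show "s_spherical (spherical_dist (P ! i) (P ! j)) = sin r * \<bar>half_chord (f i) (f j)\<bar>"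
      by (simp only: s_spherical_def spherical_dist_def power2_eq_iff_nonneg)
  next
    fix A B and t :: real assume "A \<in> set P" "B \<in> set P" "0 < t" "t < 1"
    then show "(if t *\<^sub>R A + (1 - t) *\<^sub>R B = 0 then axis 1 1
        else (t *\<^sub>R A + (1 - t) *\<^sub>R B) /\<^sub>R norm (t *\<^sub>R A + (1 - t) *\<^sub>R B))
      \<in> segment unit_sphere spherical_dist A B"
      using spherical_radial_projection_in_segment[of A B t] unit by blast
  qed
qed

section \<open>The Minkowski form\<close>

lemma minkowski_add_left: "minkowski (x + y) z = minkowski x z + minkowski y z"
  by (simp add: minkowski_def algebra_simps)

lemma minkowski_scaleR_left: "minkowski (a *\<^sub>R x) z = a * minkowski x z"
  by (simp add: minkowski_def algebra_simps)

lemma minkowski_commute: "minkowski x y = minkowski y x"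
  by (simp add: minkowski_def mult.commute)

lemma minkowski_add_right: "minkowski z (x + y) = minkowski z x + minkowski z y"
  by (simp add: minkowski_commute[of z] minkowski_add_left)

lemma minkowski_scaleR_right: "minkowski z (a *\<^sub>R x) = a * minkowski z x"
  by (simp add: minkowski_commute[of z] minkowski_scaleR_left)

text \<open>Reversed Cauchy-Schwarz inequality: on the hyperboloid the difference of the squares of
  the two sides is a sum of three squares.\<close>

lemma minkowski_le_minus_one:
  assumes "x \<in> hyperbolic_plane" "y \<in> hyperbolic_plane"
  shows "1 \<le> - minkowski x y"
proof -
  have x: "(x $ 3)\<^sup>2 = 1 + (x $ 1)\<^sup>2 + (x $ 2)\<^sup>2" "x $ 3 > 0"
    and y: "(y $ 3)\<^sup>2 = 1 + (y $ 1)\<^sup>2 + (y $ 2)\<^sup>2" "y $ 3 > 0"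
    using assms by (auto simp: hyperbolic_plane_def minkowski_def power2_eq_square)
  have "(x $ 3 * y $ 3)\<^sup>2 = (1 + x $ 1 * y $ 1 + x $ 2 * y $ 2)\<^sup>2 + (x $ 1 - y $ 1)\<^sup>2
      + (x $ 2 - y $ 2)\<^sup>2 + (x $ 1 * y $ 2 - x $ 2 * y $ 1)\<^sup>2"
    unfolding power_mult_distrib x(1) y(1) by algebra
  then have "(1 + x $ 1 * y $ 1 + x $ 2 * y $ 2)\<^sup>2 \<le> (x $ 3 * y $ 3)\<^sup>2"
    by simp
  then have "1 + x $ 1 * y $ 1 + x $ 2 * y $ 2 \<le> x $ 3 * y $ 3"
    by (rule power2_le_imp_le) (use x(2) y(2) in simp)
  then show ?thesis by (simp add: minkowski_def)
qed

lemma hyperbolic_radial_projection_in_segment: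
  assumes A: "A \<in> hyperbolic_plane" and B: "B \<in> hyperbolic_plane" and t: "0 < t" "t < 1"
    and Y: "Y = t *\<^sub>R A + (1 - t) *\<^sub>R B"
  shows "Y /\<^sub>R sqrt (- minkowski Y Y) \<in> segment hyperbolic_plane hyperbolic_dist A B"
proof -
  define c where "c = - minkowski A B"
  define w where "w = sqrt (- minkowski Y Y)"
  have AB: "minkowski A A = - 1" "minkowski B B = - 1" "A $ 3 > 0" "B $ 3 > 0"
    using A B by (auto simp: hyperbolic_plane_def)
  have c: "1 \<le> c" using minkowski_le_minus_one[OF A B] by (simp add: c_def)
  have YY: "- minkowski Y Y = t\<^sup>2 + (1 - t)\<^sup>2 + 2 * t * (1 - t) * c"
    unfolding Y c_def minkowski_add_left minkowski_add_right minkowski_scaleR_left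
      minkowski_scaleR_right AB minkowski_commute[of B A] by algebra
  have "0 < t\<^sup>2 + (1 - t)\<^sup>2 + 2 * t * (1 - t) * c"
    using t c by (intro add_pos_nonneg add_pos_nonneg) auto
  then have w: "0 < w" "w\<^sup>2 = t\<^sup>2 + (1 - t)\<^sup>2 + 2 * t * (1 - t) * c"
    by (auto simp: w_def YY)
  have "- minkowski A (Y /\<^sub>R w) = (t + (1 - t) * c) / w"
    "- minkowski (Y /\<^sub>R w) B = ((1 - t) + t * c) / w"
    unfolding Y c_def minkowski_add_left minkowski_add_right minkowski_scaleR_left
      minkowski_scaleR_right AB by (simp_all add: divide_inverse algebra_simps)
  then have "hyperbolic_dist A (Y /\<^sub>R w) + hyperbolic_dist (Y /\<^sub>R w) B = hyperbolic_dist A B"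
    using arcosh_add_on_chord[OF t c w] by (simp only: hyperbolic_dist_def c_def)
  moreover have "minkowski (Y /\<^sub>R w) (Y /\<^sub>R w) = - 1"
  proof -
    have "minkowski Y Y = - w\<^sup>2" using YY w(2) by simp
    then show ?thesis
      using w(1) by (simp add: minkowski_scaleR_left minkowski_scaleR_right power2_eq_square field_simps)
  qed
  moreover have "(Y /\<^sub>R w) $ 3 > 0"
    using w(1) t AB by (simp add: Y add_pos_pos)
  ultimately show ?thesis
    unfolding w_def [symmetric] by (simp add: segment_def hyperbolic_plane_def)
qed

text \<open>The Lorentz boost taking \<open>(0, 0, 1)\<close> to \<open>c\<close> provides a Minkowski-orthonormal basis.\<close>

lemma hyperbolic_orthonormal_basis:
  assumes "c \<in> hyperbolic_plane"
  obtains u v where "minkowski u u = 1" "minkowski v v = 1" "minkowski u v = 0"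
    "minkowski u c = 0" "minkowski v c = 0"
    "\<And>x. x = (- minkowski x c) *\<^sub>R c + minkowski x u *\<^sub>R u + minkowski x v *\<^sub>R v"
proof -
  define a b h where "a = c $ 1" "b = c $ 2" "h = c $ 3"
  have h: "h * h = 1 + a * a + b * b" "h > 0"
    using assms by (auto simp: hyperbolic_plane_def minkowski_def a_b_h_def)
  \<comment> \<open>This makes \<open>(a * a + b * b) * k = h - 1\<close>. The vectors
    \<open>u\<close> and \<open>v\<close> are the first two columns of the boost, whose spatial
    block is the identity plus \<open>k\<close> times the outer product of \<open>(a, b)\<close>
    with itself.\<close>
  define k where "k = 1 / (1 + h)"
  have k: "k * (1 + h) = 1" using h(2) by (simp add: k_def)
  define u :: "real ^ 3" where "u = vector [1 + a * a * k, a * b * k, a]"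
  define v :: "real ^ 3" where "v = vector [a * b * k, 1 + b * b * k, b]"
  have c: "c $ 1 = a" "c $ 2 = b" "c $ 3 = h" by (simp_all add: a_b_h_def)
  have u: "u $ 1 = 1 + a * a * k" "u $ 2 = a * b * k" "u $ 3 = a"
    and v: "v $ 1 = a * b * k" "v $ 2 = 1 + b * b * k" "v $ 3 = b"
    by (simp_all add: u_def v_def vector_3)
  show thesis
  proof
    show "minkowski u u = 1" "minkowski v v = 1" "minkowski u v = 0"
      "minkowski u c = 0" "minkowski v c = 0"
      unfolding minkowski_def u v c using h(1) k by algebra+
    fix x :: "real ^ 3"
    show "x = (- minkowski x c) *\<^sub>R c + minkowski x u *\<^sub>R u + minkowski x v *\<^sub>R v"
      unfolding vec_eq_iff forall_3 minkowski_def
        vector_add_component vector_scaleR_component u v c real_scaleR_def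
      using h(1) k by (intro conjI) algebra+
  qed
qed

lemma hyperbolic_cyclic_polygon_realized:
  assumes "cyclic_polygon hyperbolic_plane hyperbolic_dist n P r"
  shows "\<exists>\<theta>. realized_by s_hyperbolic hyperbolic_dist P (s_hyperbolic (2 * r)) \<theta>"
proof -
  obtain c where poly: "polygon hyperbolic_plane hyperbolic_dist P" and r: "r > 0"
    and c: "c \<in> hyperbolic_plane" and cr: "\<And>X. X \<in> set P \<Longrightarrow> arcosh (- minkowski c X) = r"
    using assms by (auto simp: cyclic_polygon_def hyperbolic_dist_def)
  have mem: "X \<in> hyperbolic_plane" if "X \<in> set P" for X
    using poly that by (auto simp: polygon_def)
  have cosh_r: "minkowski X c = - cosh r" if "X \<in> set P" for X
    using cr[OF that] minkowski_le_minus_one[OF c mem[OF that]] cosh_arcosh_real[of "- minkowski c X"]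
    by (simp add: minkowski_commute[of X c])
  obtain u v where uv: "minkowski u u = 1" "minkowski v v = 1" "minkowski u v = 0"
    "minkowski u c = 0" "minkowski v c = 0"
    and expand: "\<And>x. x = (- minkowski x c) *\<^sub>R c + minkowski x u *\<^sub>R u + minkowski x v *\<^sub>R v"
    using hyperbolic_orthonormal_basis[OF c] by blast
  have cc: "minkowski c c = - 1" using c by (simp add: hyperbolic_plane_def)
  have comb: "minkowski (a *\<^sub>R c + x *\<^sub>R u + y *\<^sub>R v) (a' *\<^sub>R c + x' *\<^sub>R u + y' *\<^sub>R v)
      = x * x' + y * y' - a * a'" for a x y a' x' y'
    using uv minkowski_commute[of c u] minkowski_commute[of c v] minkowski_commute[of v u]
    by (simp add: minkowski_add_left minkowski_add_right minkowski_scaleR_left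
        minkowski_scaleR_right cc)
  have "\<exists>\<phi>. X = cosh r *\<^sub>R c + (sinh r * cos \<phi>) *\<^sub>R u + (sinh r * sin \<phi>) *\<^sub>R v"
    if X: "X \<in> set P" for X
  proof -
    have X_eq: "X = cosh r *\<^sub>R c + minkowski X u *\<^sub>R u + minkowski X v *\<^sub>R v"
      using expand[of X] cosh_r[OF X] by simp
    have "minkowski X X = - 1" using mem[OF X] by (simp add: hyperbolic_plane_def)
    then have "(minkowski X u)\<^sup>2 + (minkowski X v)\<^sup>2 - (cosh r)\<^sup>2 = - 1"
      by (metis X_eq comb power2_eq_square)
    then have "(minkowski X u)\<^sup>2 + (minkowski X v)\<^sup>2 = (sinh r)\<^sup>2"
      by (simp add: cosh_square_eq)
    then obtain \<phi> where "minkowski X u = sinh r * cos \<phi>" "minkowski X v = sinh r * sin \<phi>"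
      by (rule polar_coordinates)
    then show ?thesis using X_eq by metis
  qed
  then obtain \<phi> where \<phi>: "\<And>X. X \<in> set P \<Longrightarrow>
      X = cosh r *\<^sub>R c + (sinh r * cos (\<phi> X)) *\<^sub>R u + (sinh r * sin (\<phi> X)) *\<^sub>R v"
    by metis
  define f where "f i = \<phi> (P ! i)" for i
  have f: "P ! i = cosh r *\<^sub>R c + (sinh r * cos (f i)) *\<^sub>R u + (sinh r * sin (f i)) *\<^sub>R v"
    if "i < length P" for i
    unfolding f_def using \<phi>[of "P ! i"] that by simp
  have sinh_r: "sinh r \<ge> 0" using r by simp
  have "s_hyperbolic (2 * r) = sinh r" by (simp add: s_hyperbolic_def)
  show ?thesis
    unfolding \<open>s_hyperbolic (2 * r) = sinh r\<close>
  proof (rule polygon_on_circle_realized[OF poly f _ sinh_r,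
      where N = "\<lambda>Y. Y /\<^sub>R sqrt (- minkowski Y Y)"])
    fix i j assume ij: "i < length P" "j < length P"
    let ?p = "- minkowski (P ! i) (P ! j)"
    have p: "1 \<le> ?p" using ij by (intro minkowski_le_minus_one mem) auto
    have "?p = (cosh r)\<^sup>2 - (sinh r)\<^sup>2 * (cos (f i) * cos (f j) + sin (f i) * sin (f j))"
      unfolding f[OF ij(1)] f[OF ij(2)] comb by (simp add: power2_eq_square algebra_simps)
    also have "\<dots> = 1 + 2 * (sinh r * \<bar>half_chord (f i) (f j)\<bar>)\<^sup>2"
      by (simp add: power_mult_distrib half_chord_square cosh_square_eq field_simps)
    finally have p_eq: "?p = 1 + 2 * (sinh r * \<bar>half_chord (f i) (f j)\<bar>)\<^sup>2" .
    have "2 * (arcosh ?p / 2) = arcosh ?p" by simp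
    then have "?p = (cosh (arcosh ?p / 2))\<^sup>2 + (sinh (arcosh ?p / 2))\<^sup>2"
      using cosh_double[of "arcosh ?p / 2"] cosh_arcosh_real[OF p] by metis
    with p_eq have "(sinh (arcosh ?p / 2))\<^sup>2 = (sinh r * \<bar>half_chord (f i) (f j)\<bar>)\<^sup>2"
      by (simp add: cosh_square_eq)
    moreover have "sinh (arcosh ?p / 2) \<ge> 0" using arcosh_nonneg_real[OF p] by simp
    moreover have "sinh r * \<bar>half_chord (f i) (f j)\<bar> \<ge> 0" using sinh_r by simp
    ultimately show "s_hyperbolic (hyperbolic_dist (P ! i) (P ! j)) = sinh r * \<bar>half_chord (f i) (f j)\<bar>"
      by (simp only: s_hyperbolic_def hyperbolic_dist_def power2_eq_iff_nonneg)
  next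
    fix A B and t :: real assume "A \<in> set P" "B \<in> set P" "0 < t" "t < 1"
    then show "(t *\<^sub>R A + (1 - t) *\<^sub>R B) /\<^sub>R
        sqrt (- minkowski (t *\<^sub>R A + (1 - t) *\<^sub>R B) (t *\<^sub>R A + (1 - t) *\<^sub>R B))
      \<in> segment hyperbolic_plane hyperbolic_dist A B"
      using hyperbolic_radial_projection_in_segment[of A B t] mem by blast
  qed
qed

section \<open>The diagonals and the circumradius\<close>

lemma admissible_values_cyclic_angles:
  assumes "a \<in> admissible_values n"
  obtains R \<theta> where "cyclic_angles n R \<theta>" "a = map (\<lambda>k. R * sin (\<theta> k)) [0..<n]"
proof -
  have *: "\<exists>R \<theta>. cyclic_angles n R \<theta> \<and> side_values s d P = map (\<lambda>k. R * sin (\<theta> k)) [0..<n]"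
    if "cyclic_polygon M d n P r" "\<exists>\<theta>. realized_by s d P R \<theta>"
    for M and s and d :: "'a \<Rightarrow> 'a \<Rightarrow> real" and P r R
    using that by (auto simp: realized_by_def cyclic_polygon_def)
  from assms show thesis
    unfolding admissible_values_def
    using that *[OF _ euclidean_cyclic_polygon_realized] *[OF _ hyperbolic_cyclic_polygon_realized]
      *[OF _ spherical_cyclic_polygon_realized] by blast
qed

text \<open>The common source of both algebraicity claims: a diagonal takes for \<open>g\<close> the
  sine of a partial sum, the circumradius the constant 1.\<close>

lemma algebraic_on_admissible_values:
  assumes n: "n \<ge> 3" and g: "g \<in> trig_forms (n - 1) 1"
    and f: "\<And>R \<theta>. cyclic_angles n R \<theta> \<Longrightarrow> f (map (\<lambda>k. R * sin (\<theta> k)) [0..<n]) = R * g \<theta>"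
  shows "algebraic_on n (admissible_values n) f"
proof -
  obtain p where p: "irreducible p" "mpoly_vars p \<subseteq> {..n}" "n \<in> mpoly_vars p"
    and van: "\<And>R \<theta>. (\<Sum>k<n. \<theta> k) = pi \<Longrightarrow>
      mpoly_eval p (\<lambda>v. if v < n then R * sin (\<theta> v) else R * g \<theta>) = 0"
    using cyclic_irreducible_relation[OF n g] by blast
  have "mpoly_eval p (\<lambda>v. (a @ [f a]) ! v) = 0" if a_adm: "a \<in> admissible_values n" for a
  proof -
    obtain R \<theta> where \<theta>: "cyclic_angles n R \<theta>" and a: "a = map (\<lambda>k. R * sin (\<theta> k)) [0..<n]"
      using admissible_values_cyclic_angles[OF a_adm] by blast
    have "mpoly_eval p (\<lambda>v. (a @ [f a]) ! v)
        = mpoly_eval p (\<lambda>v. if v < n then R * sin (\<theta> v) else R * g \<theta>)"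
    proof (rule mpoly_eval_cong)
      fix v assume "v \<in> mpoly_vars p"
      then have "v \<le> n" using p(2) by auto
      then show "(a @ [f a]) ! v = (if v < n then R * sin (\<theta> v) else R * g \<theta>)"
        using f[OF \<theta>] by (auto simp: a nth_append)
    qed
    then show ?thesis using van \<theta> by (simp add: cyclic_angles_def)
  qed
  with p show ?thesis unfolding algebraic_on_def by blast
qed

section \<open>The functions F_ij and G\<close>

text \<open>For at least three sides the choice is forced by \<open>cyclic_angles_unique\<close>,
  except for the angles with index \<open>length a\<close> or more, which stay arbitrary.\<close>

definition side_parameters :: "real list \<Rightarrow> real \<times> (nat \<Rightarrow> real)" where
  "side_parameters a = (SOME (R, \<theta>). cyclic_angles (length a) R \<theta> \<and>
     a = map (\<lambda>k. R * sin (\<theta> k)) [0..<length a])"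

lemma side_parameters_map:
  assumes n: "n \<ge> 3" and \<theta>: "cyclic_angles n R \<theta>"
  defines "a \<equiv> map (\<lambda>k. R * sin (\<theta> k)) [0..<n]"
  shows "fst (side_parameters a) = R" "\<And>k. k < n \<Longrightarrow> snd (side_parameters a) k = \<theta> k"
proof -
  obtain R' \<theta>' where p: "side_parameters a = (R', \<theta>')" by (cases "side_parameters a")
  have len: "length a = n" by (simp add: a_def)
  have "case side_parameters a of (R, \<theta>) \<Rightarrow> cyclic_angles (length a) R \<theta> \<and>
     a = map (\<lambda>k. R * sin (\<theta> k)) [0..<length a]"
    unfolding side_parameters_def by (rule someI[of _ "(R, \<theta>)"]) (use \<theta> in \<open>simp add: a_def\<close>)
  then have \<theta>': "cyclic_angles n R' \<theta>'" and eq: "a = map (\<lambda>k. R' * sin (\<theta>' k)) [0..<n]"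
    unfolding p prod.case len by blast+
  have "R * sin (\<theta> k) = R' * sin (\<theta>' k)" if "k < n" for k
    using that arg_cong[OF eq, of "\<lambda>xs. xs ! k"] by (simp add: a_def)
  from cyclic_angles_unique[OF \<theta> \<theta>' n this]
  show "fst (side_parameters a) = R" "\<And>k. k < n \<Longrightarrow> snd (side_parameters a) k = \<theta> k"
    by (auto simp: p)
qed

text \<open>The scale of the model is already \<open>s (2 * r)\<close>, not
  \<open>r\<close>.\<close>

definition circumradius_function :: "real list \<Rightarrow> real" where
  "circumradius_function a = fst (side_parameters a)"

definition diagonal_function :: "nat \<Rightarrow> nat \<Rightarrow> real list \<Rightarrow> real" where
  "diagonal_function i j a =
     fst (side_parameters a) * sin (\<Sum>k\<in>{min i j..<max i j}. snd (side_parameters a) k)"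

lemma diagonal_function_map:
  assumes "n \<ge> 3" "cyclic_angles n R \<theta>" "i < n" "j < n"
  shows "diagonal_function i j (map (\<lambda>k. R * sin (\<theta> k)) [0..<n])
    = R * sin (\<Sum>k\<in>{min i j..<max i j}. \<theta> k)"
proof -
  have "(\<Sum>k\<in>{min i j..<max i j}. snd (side_parameters (map (\<lambda>k. R * sin (\<theta> k)) [0..<n])) k)
      = (\<Sum>k\<in>{min i j..<max i j}. \<theta> k)"
    by (rule sum.cong) (use assms in \<open>auto simp: side_parameters_map(2)\<close>)
  then show ?thesis
    using side_parameters_map(1)[OF assms(1,2)] by (simp add: diagonal_function_def)
qed

lemma realized_by_functions:
  assumes "cyclic_polygon M d n P r" "n \<ge> 3" "\<exists>\<theta>. realized_by s d P R \<theta>"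
  shows "(\<forall>i<n. \<forall>j<n. \<bar>int j - int i\<bar> \<ge> 2 \<longrightarrow>
      s (d (P ! i) (P ! j)) = diagonal_function i j (side_values s d P)) \<and>
    R = circumradius_function (side_values s d P)"
proof -
  have len: "length P = n" using assms(1) by (simp add: cyclic_polygon_def)
  obtain \<theta> where \<theta>: "cyclic_angles n R \<theta>"
    and sides: "side_values s d P = map (\<lambda>k. R * sin (\<theta> k)) [0..<n]"
    and diag: "\<And>i j. i < n \<Longrightarrow> j < n \<Longrightarrow> i \<noteq> j \<Longrightarrow>
      s (d (P ! i) (P ! j)) = R * sin (\<Sum>k\<in>{min i j..<max i j}. \<theta> k)"
    using assms(3) unfolding realized_by_def len by blast
  show ?thesis
  proof (intro conjI allI impI)
    fix i j assume ij: "i < n" "j < n" "\<bar>int j - int i\<bar> \<ge> 2"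
    then have "i \<noteq> j" by auto
    then show "s (d (P ! i) (P ! j)) = diagonal_function i j (side_values s d P)"
      using diag[OF ij(1,2)] diagonal_function_map[OF assms(2) \<theta> ij(1,2)] by (simp add: sides)
  next
    show "R = circumradius_function (side_values s d P)"
      using side_parameters_map(1)[OF assms(2) \<theta>] by (simp add: sides circumradius_function_def)
  qed
qed

theorem corollary3:
  fixes n :: nat
  assumes "n \<ge> 3"
  shows "\<exists>(F :: nat \<Rightarrow> nat \<Rightarrow> real list \<Rightarrow> real) (G :: real list \<Rightarrow> real).
    (\<forall>i < n. \<forall>j < n. \<bar>int j - int i\<bar> \<ge> 2 \<longrightarrow> algebraic_on n (admissible_values n) (F i j)) \<and>
    algebraic_on n (admissible_values n) G \<and>
    (\<forall>(P :: (real ^ 2) list) r. cyclic_polygon UNIV dist n P r \<longrightarrow>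
      (\<forall>i < n. \<forall>j < n. \<bar>int j - int i\<bar> \<ge> 2 \<longrightarrow>
        s_euclidean (dist (P ! i) (P ! j)) = F i j (side_values s_euclidean dist P)) \<and>
      s_euclidean (2 * r) = G (side_values s_euclidean dist P)) \<and>
    (\<forall>P r. cyclic_polygon hyperbolic_plane hyperbolic_dist n P r \<longrightarrow>
      (\<forall>i < n. \<forall>j < n. \<bar>int j - int i\<bar> \<ge> 2 \<longrightarrow>
        s_hyperbolic (hyperbolic_dist (P ! i) (P ! j)) =
          F i j (side_values s_hyperbolic hyperbolic_dist P)) \<and>
      s_hyperbolic (2 * r) = G (side_values s_hyperbolic hyperbolic_dist P)) \<and>
    (\<forall>P r. cyclic_polygon unit_sphere spherical_dist n P r \<longrightarrow>
      (\<forall>i < n. \<forall>j < n. \<bar>int j - int i\<bar> \<ge> 2 \<longrightarrow>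
        s_spherical (spherical_dist (P ! i) (P ! j)) =
          F i j (side_values s_spherical spherical_dist P)) \<and>
      s_spherical (2 * r) = G (side_values s_spherical spherical_dist P))"
proof (intro exI[of _ diagonal_function] exI[of _ circumradius_function] conjI)
  show "\<forall>i<n. \<forall>j<n. \<bar>int j - int i\<bar> \<ge> 2 \<longrightarrow>
      algebraic_on n (admissible_values n) (diagonal_function i j)"
  proof (intro allI impI)
    fix i j assume ij: "i < n" "j < n"
    have "(\<lambda>\<theta>. sin (\<Sum>k\<in>{min i j..<max i j}. \<theta> k)) \<in> trig_forms (n - 1) 1"
      using ij by (intro trig_forms_sin_sum) auto
    then show "algebraic_on n (admissible_values n) (diagonal_function i j)"
      by (rule algebraic_on_admissible_values[OF assms])
        (simp add: diagonal_function_map assms ij)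
  qed
  show "algebraic_on n (admissible_values n) circumradius_function"
    by (rule algebraic_on_admissible_values[OF assms trig_forms_one])
      (simp add: circumradius_function_def side_parameters_map(1) assms)
qed (intro allI impI,
    (rule realized_by_functions[OF _ assms euclidean_cyclic_polygon_realized] |
     rule realized_by_functions[OF _ assms hyperbolic_cyclic_polygon_realized] |
     rule realized_by_functions[OF _ assms spherical_cyclic_polygon_realized]),
    assumption+)+

end
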